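(* Let $X_1,\dots,X_n$ be i.i.d. real random variables with distribution function $F$ and let $F(\theta_0)=1/2$. Suppose there exist $M,C,\delta,\eta>0$ such that $$|F(\theta_0+h)-F(\theta_0)-Mh|\le C|h|^{1+\delta}\quad\text{for all } |h|<\eta.$$ Define $\zeta:=(M/2)\min\{\eta,(M/(2C))^{1/\delta}\}$. Then for any $\alpha\in(0,1)$ and any integer $n\ge\log_2(2/\alpha)$ such that $n\ge 49\log(2n/\alpha)/\zeta^2$, with probability at least $1-6n^{-2}$, $$\left|\mathrm{WR}_{n,\alpha}-1\right|\le\frac{1+14\log(n)/z_{\alpha/2}}{n^{1/4}}+\sqrt{\frac{\log(2/\alpha)}{8n}}+\frac{2C(14)^{1+\delta}(\log(2n/\alpha))^{(1+\delta)/2}}{z_{\alpha/2}M^{1+\delta}n^{\delta/2}}.$$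
   Context: $z_{\alpha/2}$ is the $(1-\alpha/2)$-quantile of the standard normal distribution; $X_{(1)}\le\dots\le X_{(n)}$ are the order statistics; $\log$ is the natural logarithm. With $Y_n\sim\mathrm{Bin}(n,1/2)$, $c_{n,\alpha}$ is the smallest integer $x$ such that $\mathbb{P}(Y_n\ge\lfloor n/2\rfloor-x)\ge 1-\alpha/2$. For $n\ge\log_2(2/\alpha)$ the distribution-free confidence interval for the median is $\widehat{\mathrm{CI}}_{n,\alpha}=[X_{(\lfloor n/2\rfloor-c_{n,\alpha})},X_{(\lceil n/2\rceil+c_{n,\alpha}+1)}]$. The oracle Wald interval is $\left[X_{(\lceil n/2\rceil)}-\frac{z_{\alpha/2}}{2M\sqrt n},\ X_{(\lceil n/2\rceil)}+\frac{z_{\alpha/2}}{2M\sqrt n}\right]$, of width $z_{\alpha/2}/(M\sqrt n)$. The width ratio is $$\mathrm{WR}_{n,\alpha}=\frac{\text{width of }\widehat{\mathrm{CI}}_{n,\alpha}}{\text{width of the oracle Wald interval}}=\frac{\sqrt n\,M}{z_{\alpha/2}}\left(X_{(\lceil n/2\rceil+c_{n,\alpha}+1)}-X_{(\lfloor n/2\rfloor-c_{n,\alpha})}\right).$$ *)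

theory Defs
  imports "HOL-Probability.Probability"
begin

definition quantile :: "real measure \<Rightarrow> real \<Rightarrow> real" where
  "quantile \<mu> p = Inf {x. p \<le> cdf \<mu> x}"

(* upper quantile: normal_z a is the (1 - a)-quantile of N(0,1) *)
definition normal_z :: "real \<Rightarrow> real" where
  "normal_z a = quantile (density lborel std_normal_density) (1 - a)"

(* k-th smallest of x 1, ..., x n, counted with multiplicity; meaningful for 1 \<le> k \<le> n *)
definition order_stat :: "nat \<Rightarrow> (nat \<Rightarrow> real) \<Rightarrow> nat \<Rightarrow> real" where
  "order_stat n x k = sort (map x [1..<Suc n]) ! (k - 1)"

definition median_c :: "nat \<Rightarrow> real \<Rightarrow> int" where
  "median_c n \<alpha> = (LEAST x::int.
     measure_pmf.prob (binomial_pmf n (1/2)) {y. int y \<ge> \<lfloor>real n / 2\<rfloor> - x} \<ge> 1 - \<alpha> / 2)"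

(* For 0 < \<alpha> < 1 and n \<ge> log 2 (2/\<alpha>) one has 0 \<le> median_c n \<alpha> < \<lfloor>n/2\<rfloor>, so that both
   indices lie in {1..n} and the conversions by nat do not truncate. *)
definition median_CI :: "nat \<Rightarrow> real \<Rightarrow> (nat \<Rightarrow> real) \<Rightarrow> real set" where
  "median_CI n \<alpha> x =
     {order_stat n x (nat (\<lfloor>real n / 2\<rfloor> - median_c n \<alpha>)) ..
      order_stat n x (nat (\<lceil>real n / 2\<rceil> + median_c n \<alpha> + 1))}"

definition wald_CI :: "nat \<Rightarrow> real \<Rightarrow> real \<Rightarrow> (nat \<Rightarrow> real) \<Rightarrow> real set" where
  "wald_CI n \<alpha> M x =
     {order_stat n x (nat \<lceil>real n / 2\<rceil>) - normal_z (\<alpha> / 2) / (2 * M * sqrt (real n)) ..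
      order_stat n x (nat \<lceil>real n / 2\<rceil>) + normal_z (\<alpha> / 2) / (2 * M * sqrt (real n))}"

definition interval_width :: "real set \<Rightarrow> real" where
  "interval_width I = measure lborel I"

definition width_ratio :: "nat \<Rightarrow> real \<Rightarrow> real \<Rightarrow> (nat \<Rightarrow> real) \<Rightarrow> real" where
  "width_ratio n \<alpha> M x =
     interval_width (median_CI n \<alpha> x) / interval_width (wald_CI n \<alpha> M x)"

lemma width_ratio_eq:
  assumes "M > 0" "normal_z (\<alpha> / 2) \<ge> 0"
    and "order_stat n x (nat (\<lfloor>real n / 2\<rfloor> - median_c n \<alpha>))
       \<le> order_stat n x (nat (\<lceil>real n / 2\<rceil> + median_c n \<alpha> + 1))"
  shows "width_ratio n \<alpha> M x = sqrt (real n) * M / normal_z (\<alpha> / 2) *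
     (order_stat n x (nat (\<lceil>real n / 2\<rceil> + median_c n \<alpha> + 1))
      - order_stat n x (nat (\<lfloor>real n / 2\<rfloor> - median_c n \<alpha>)))"
proof -
  have "0 \<le> normal_z (\<alpha> / 2) / (2 * M * sqrt (real n))"
    using assms by simp
  then have "interval_width (wald_CI n \<alpha> M x) = normal_z (\<alpha> / 2) / (M * sqrt (real n))"
    by (simp add: interval_width_def wald_CI_def)
  then show ?thesis
    using assms by (simp add: width_ratio_def interval_width_def median_CI_def)
qed

end

theory Submission
  imports Defs
begin

text \<open>
  Spacing: on a grid of \<open>n\<close> points covering a neighbourhood of the median in which \<open>F\<close> is almost
  linear, a Chernoff bound for the number of observations in each interval that starts at a grid
  point controls the distance of the \<open>u\<close>-th and the \<open>l\<close>-th order statistic in terms of \<open>u - l\<close>,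
  up to an error of order \<open>n powr (1/4) * ln n\<close> in the count.

  Index gap: for the indices of the confidence interval, \<open>u - l\<close> is \<open>2 c\<close> plus 1 or 2, where \<open>c\<close> is a
  binomial quantile. Binomial point masses are compared with the masses which a normal distribution
  gives to equally long cells. The ratio of consecutive binomial masses is \<open>(1 - y) / (1 + y)\<close>, that
  of consecutive cells lies between two exponentials, so the quotient of the two sequences is monotone
  and tail comparisons follow from the comparison at the median. This bounds \<open>c\<close> from above and, with
  a truncation and a slightly smaller variance, from below, which is precise enough to replace
  Tusnady's inequality.
\<close>

subsection \<open>The standard normal tail\<close>

text \<open>The level \<open>\<alpha>\<close> may be exponentially small in \<open>n\<close>, so an
  additive normal approximation of the binomial law would be useless. Tails are compared
  multiplicatively, and the quantile is recovered because a small shift of the argument changes the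
  normal tail by a relative amount that exceeds the truncation error. The scale
  \<open>q = n powr (1/4)\<close> arises because an interval of the length in question holds about
  \<open>z * sqrt n\<close> observations, whose fluctuation is of order \<open>n powr (1/4)\<close>
  up to factors in \<open>z\<close> and \<open>ln n\<close>. Multiplied by
  \<open>z * sqrt n\<close>, the claimed bound becomes a budget for counts:
  \<open>z * q + 14 * q * ln n + z * sqrt (ln (2 / \<alpha>) / 8)\<close> plus a term for the
  nonlinearity of \<open>F\<close>. On the critical lower side, half of \<open>z * q\<close> and 6
  of the 14 pay for the Chernoff bound; the other half, the other 8 and the square root pay for the
  quantile error. Since \<open>F\<close> is controlled only near the median, both order statistics
  must also be localised there. The grid fails with probability at most \<open>2 * n / n^3\<close>,
  the localisation with at most \<open>2 / n^2\<close>.\<close>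

definition normal_tail :: "real \<Rightarrow> real" where
  "normal_tail x = measure std_normal_distribution {x<..}"

lemma prob_space_std_normal: "prob_space std_normal_distribution"
  by (rule prob_space_normal_density) simp

lemma std_normal_density_shift:
  "std_normal_density (t + k) = std_normal_density t * exp (- k * t - k\<^sup>2 / 2)"
  by (simp add: normal_density_def exp_add [symmetric] power2_eq_square field_simps)

text \<open>Exponential tilting: the preimage is the translate of \<open>A\<close> by
  \<open>k\<close>, and translation multiplies the density by
  \<open>exp (- k * t - k^2 / 2)\<close>. The two lemmas that follow bound this factor at one end of
  \<open>A\<close>.\<close>

lemma emeasure_std_normal_shift:
  assumes [measurable]: "A \<in> sets borel"
  shows "emeasure std_normal_distribution ((\<lambda>t. t - k) -` A)
     = (\<integral>\<^sup>+t. ennreal (std_normal_density t * exp (- k * t - k\<^sup>2 / 2)) * indicator A t \<partial>lborel)"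
proof -
  have "(\<lambda>t. t - k) -` A = (\<lambda>t. t - k) -` A \<inter> space borel" by simp
  also have "\<dots> \<in> sets borel" by measurable
  finally have m: "(\<lambda>t. t - k) -` A \<in> sets borel" .
  have "emeasure std_normal_distribution ((\<lambda>t. t - k) -` A)
     = (\<integral>\<^sup>+t. ennreal (std_normal_density t) * indicator ((\<lambda>t. t - k) -` A) t \<partial>lborel)"
    using m by (simp add: emeasure_density)
  also have "\<dots> = (\<integral>\<^sup>+t. ennreal (std_normal_density (k + 1 * t)) * indicator ((\<lambda>t. t - k) -` A) (k + 1 * t) \<partial>lborel)"
    using m by (subst nn_integral_real_affine [where c = 1 and t = k]) (auto simp: )
  also have "\<dots> = (\<integral>\<^sup>+t. ennreal (std_normal_density t * exp (- k * t - k\<^sup>2 / 2)) * indicator A t \<partial>lborel)"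
    using std_normal_density_shift [of _ k]
    by (intro nn_integral_cong) (auto simp: indicator_def add.commute)
  finally show ?thesis .
qed

lemma std_normal_shift_le:
  assumes A: "A \<in> sets borel" and k: "k \<ge> 0" and x: "\<And>t. t \<in> A \<Longrightarrow> x \<le> t"
  shows "measure std_normal_distribution ((\<lambda>t. t - k) -` A)
     \<le> exp (- k * x - k\<^sup>2 / 2) * measure std_normal_distribution A"
proof -
  interpret prob_space std_normal_distribution by (rule prob_space_std_normal)
  have "emeasure std_normal_distribution ((\<lambda>t. t - k) -` A)
     \<le> (\<integral>\<^sup>+t. ennreal (exp (- k * x - k\<^sup>2 / 2)) * (ennreal (std_normal_density t) * indicator A t) \<partial>lborel)"
    unfolding emeasure_std_normal_shift [OF A] using k x
    by (intro nn_integral_mono)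
       (auto simp: indicator_def ennreal_mult' [symmetric] mult.commute [of "exp _"] intro!: ennreal_leI mult_left_mono)
  also have "\<dots> = ennreal (exp (- k * x - k\<^sup>2 / 2)) * emeasure std_normal_distribution A"
    using A by (simp add: nn_integral_cmult emeasure_density)
  finally show ?thesis
    by (simp add: emeasure_eq_measure ennreal_mult' [symmetric])
qed

lemma std_normal_shift_ge:
  assumes A: "A \<in> sets borel" and k: "k \<ge> 0" and y: "\<And>t. t \<in> A \<Longrightarrow> t \<le> y"
  shows "exp (- k * y - k\<^sup>2 / 2) * measure std_normal_distribution A
     \<le> measure std_normal_distribution ((\<lambda>t. t - k) -` A)"
proof -
  interpret prob_space std_normal_distribution by (rule prob_space_std_normal)
  have "ennreal (exp (- k * y - k\<^sup>2 / 2)) * emeasure std_normal_distribution A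
     = (\<integral>\<^sup>+t. ennreal (exp (- k * y - k\<^sup>2 / 2)) * (ennreal (std_normal_density t) * indicator A t) \<partial>lborel)"
    using A by (simp add: nn_integral_cmult emeasure_density)
  also have "\<dots> \<le> emeasure std_normal_distribution ((\<lambda>t. t - k) -` A)"
    unfolding emeasure_std_normal_shift [OF A] using k y
    by (intro nn_integral_mono)
       (auto simp: indicator_def ennreal_mult' [symmetric] mult.commute [of "exp _"] intro!: ennreal_leI mult_left_mono)
  finally show ?thesis
    by (simp add: emeasure_eq_measure ennreal_mult' [symmetric])
qed

lemma normal_tail_diff:
  assumes "x \<le> y"
  shows "measure std_normal_distribution {x<..y} = normal_tail x - normal_tail y"
proof -
  interpret prob_space std_normal_distribution by (rule prob_space_std_normal)
  have eq: "{x<..} = {x<..y} \<union> {y<..}" using assms by auto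
  have "measure std_normal_distribution ({x<..y} \<union> {y<..})
      = measure std_normal_distribution {x<..y} + measure std_normal_distribution {y<..}"
    by (rule finite_measure_Union) auto
  then have "normal_tail x = measure std_normal_distribution {x<..y} + normal_tail y"
    by (simp only: normal_tail_def eq [symmetric])
  then show ?thesis by simp
qed

text \<open>The density is positive everywhere, so an interval without mass would be a Lebesgue null
  set. Strictness makes the cells below positive and the normal quantile unique.\<close>

lemma normal_tail_strict_antimono:
  assumes "x < y"
  shows "normal_tail y < normal_tail x"
proof -
  interpret prob_space std_normal_distribution by (rule prob_space_std_normal)
  have "emeasure std_normal_distribution {x<..y} \<noteq> 0"
  proof
    assume "emeasure std_normal_distribution {x<..y} = 0"
    then have "AE t in lborel. ennreal (std_normal_density t) * indicator {x<..y} t = 0"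
      by (simp add: emeasure_density nn_integral_0_iff_AE)
    then have "AE t in lborel. t \<notin> {x<..y}"
    proof (rule AE_mp, intro AE_I2 impI)
      fix t assume "ennreal (std_normal_density t) * indicator {x<..y} t = 0"
      then show "t \<notin> {x<..y}"
        using normal_density_pos [of 1 0 t] by (auto simp del: normal_density_pos split: split_indicator_asm)
    qed
    then have "emeasure lborel {x<..y} = 0"
      by (subst (asm) AE_iff_measurable [OF _ refl]) (auto simp: greaterThanAtMost_def Int_def)
    then show False using assms by simp
  qed
  then have "measure std_normal_distribution {x<..y} > 0"
    by (simp add: emeasure_eq_measure zero_less_measure_iff)
  then show ?thesis using assms normal_tail_diff [of x y] by simp
qed

lemma normal_tail_antimono: "x \<le> y \<Longrightarrow> normal_tail y \<le> normal_tail x"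
  using normal_tail_strict_antimono [of x y] by (cases "x = y") auto

lemma normal_tail_shift:
  assumes "k \<ge> 0"
  shows "normal_tail (x + k) \<le> exp (- k * x - k\<^sup>2 / 2) * normal_tail x"
proof -
  have "(\<lambda>t. t - k) -` {x<..} = {x + k<..}" by auto
  then show ?thesis
    using std_normal_shift_le [of "{x<..}" k x] assms by (simp add: normal_tail_def)
qed

lemma cdf_std_normal: "cdf std_normal_distribution x = 1 - normal_tail x"
proof -
  interpret prob_space std_normal_distribution by (rule prob_space_std_normal)
  have "{..x} = space std_normal_distribution - {x<..}" by auto
  then show ?thesis unfolding cdf_def normal_tail_def by (simp only: prob_compl sets_density sets_lborel sets.sigma_sets_eq greaterThan_borel)
qed

lemma measure_std_normal_singleton: "measure std_normal_distribution {x} = 0"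
proof -
  have "emeasure std_normal_distribution {x} = 0"
    by (auto simp: emeasure_density nn_integral_0_iff_AE intro!: AE_I [where N = "{x}"] split: split_indicator)
  then show ?thesis by (simp add: measure_def)
qed

lemma normal_tail_uminus: "normal_tail (- x) = 1 - normal_tail x"
proof -
  interpret prob_space std_normal_distribution by (rule prob_space_std_normal)
  have "emeasure std_normal_distribution {- x<..}
      = (\<integral>\<^sup>+t. ennreal (std_normal_density t) * indicator {- x<..} t \<partial>lborel)"
    by (simp add: emeasure_density)
  also have "\<dots> = (\<integral>\<^sup>+t. ennreal (std_normal_density (0 + (-1) * t)) * indicator {- x<..} (0 + (-1) * t) \<partial>lborel)"
    by (subst nn_integral_real_affine [where c = "-1" and t = 0]) auto
  also have "\<dots> = (\<integral>\<^sup>+t. ennreal (std_normal_density t) * indicator {..<x} t \<partial>lborel)"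
    by (intro nn_integral_cong) (auto simp: indicator_def normal_density_def)
  also have "\<dots> = emeasure std_normal_distribution {..<x}"
    by (simp add: emeasure_density)
  finally have 1: "normal_tail (- x) = measure std_normal_distribution {..<x}"
    by (simp add: normal_tail_def measure_def)
  have "{..x} = {..<x} \<union> {x}" by auto
  then have "measure std_normal_distribution {..x}
      = measure std_normal_distribution {..<x} + measure std_normal_distribution {x}"
    using finite_measure_Union [of "{..<x}" "{x}"] by simp
  then show ?thesis
    using 1 cdf_std_normal [of x] by (simp add: cdf_def measure_std_normal_singleton)
qed

lemma normal_tail_0: "normal_tail 0 = 1 / 2"
  using normal_tail_uminus [of 0] by simp

lemma normal_tail_bound: "x \<ge> 0 \<Longrightarrow> normal_tail x \<le> exp (- x\<^sup>2 / 2)"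
  using normal_tail_shift [of x 0] by (simp add: normal_tail_0)
    (smt (verit) exp_ge_zero)

text \<open>Points have mass zero, so the cdf is continuous and takes the value \<open>1 - a\<close>
  at some \<open>x\<close>. Strict monotonicity makes the set under the infimum of
  \<open>quantile\<close> exactly \<open>{x..}\<close>.\<close>

lemma normal_tail_normal_z:
  assumes a: "0 < a" "a < 1"
  shows "normal_tail (normal_z a) = a"
proof -
  interpret real_distribution std_normal_distribution
    using prob_space_std_normal by (simp add: real_distribution_def real_distribution_axioms_def)
  have cont: "isCont (cdf std_normal_distribution) x" for x
    by (simp add: isCont_cdf measure_std_normal_singleton)
  have "\<exists>l. cdf std_normal_distribution l < 1 - a"
    using order_tendstoD(2) [OF cdf_lim_at_bot, of "1 - a"] a
    by (auto simp: eventually_at_bot_linorder)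
  then obtain l where l: "cdf std_normal_distribution l < 1 - a" by blast
  have "\<exists>u. cdf std_normal_distribution u > 1 - a"
    using order_tendstoD(1) [OF cdf_lim_at_top_prob, of "1 - a"] a
    by (auto simp: eventually_at_top_linorder)
  then obtain u where u: "cdf std_normal_distribution u > 1 - a" by blast
  have "l \<le> u" using l u cdf_nondecreasing [of u l] by linarith
  then obtain x where x: "cdf std_normal_distribution x = 1 - a"
    using IVT [of "cdf std_normal_distribution" l "1 - a" u] cont l u by auto
  have "{y. 1 - a \<le> cdf std_normal_distribution y} = {x..}"
    using x normal_tail_strict_antimono [of _ x] normal_tail_antimono [of x]
    by (auto simp: cdf_std_normal) (smt (verit, best))+
  then have "normal_z a = x" by (simp add: normal_z_def quantile_def)
  then show ?thesis using x by (simp add: cdf_std_normal)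
qed

subsection \<open>Comparison of binomial and normal tails\<close>

text \<open>Cross-multiplied form of the monotonicity of \<open>b / g\<close>. Each induction step
  cancels \<open>g m\<close>, so only \<open>g\<close> has to be positive.\<close>

lemma ratio_chain:
  fixes b g :: "nat \<Rightarrow> real"
  assumes ij: "j \<le> i" and g: "\<And>k. j \<le> k \<Longrightarrow> k \<le> i \<Longrightarrow> g k > 0"
    and step: "\<And>k. j \<le> k \<Longrightarrow> k < i \<Longrightarrow> b (Suc k) * g k \<le> b k * g (Suc k)"
  shows "b i * g j \<le> b j * g i"
  using ij g step
proof (induction i rule: dec_induct)
  case (step m)
  have IH: "b m * g j \<le> b j * g m"
    by (rule step.IH) (use step.prems in auto)
  have gm: "g m > 0" "g (Suc m) > 0" "g j > 0" using step.prems(1) step.hyps by auto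
  have "(b (Suc m) * g j) * g m = (b (Suc m) * g m) * g j" by simp
  also have "\<dots> \<le> (b m * g (Suc m)) * g j"
    using step.prems(2) [of m] step.hyps gm by (intro mult_right_mono) auto
  also have "\<dots> = (b m * g j) * g (Suc m)" by simp
  also have "\<dots> \<le> (b j * g m) * g (Suc m)"
    using IH gm by (intro mult_right_mono) auto
  finally have "(b (Suc m) * g j) * g m \<le> (b j * g (Suc m)) * g m" by (simp add: mult_ac)
  then show ?case using gm by simp
qed simp

text \<open>Monotone likelihood ratio: the chained inequality holds for every pair
  \<open>j < k <= i\<close>, and summing it over all pairs compares tail to head. It is applied
  twice, with the binomial masses as \<open>b\<close> and then as \<open>g\<close>.\<close>

lemma likelihood_ratio_tails:
  fixes b g :: "nat \<Rightarrow> real"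
  assumes g: "\<And>i. k0 \<le> i \<Longrightarrow> i \<le> m \<Longrightarrow> g i > 0"
    and step: "\<And>i. k0 \<le> i \<Longrightarrow> i < m \<Longrightarrow> b (Suc i) * g i \<le> b i * g (Suc i)"
  shows "(\<Sum>i=k..m. b i) * (\<Sum>i=k0..<k. g i) \<le> (\<Sum>i=k0..<k. b i) * (\<Sum>i=k..m. g i)"
proof -
  have "(\<Sum>i=k..m. b i) * (\<Sum>j=k0..<k. g j) = (\<Sum>i=k..m. \<Sum>j=k0..<k. b i * g j)"
    by (rule sum_product)
  also have "\<dots> \<le> (\<Sum>i=k..m. \<Sum>j=k0..<k. b j * g i)"
  proof (intro sum_mono)
    fix i j assume "i \<in> {k..m}" "j \<in> {k0..<k}"
    then show "b i * g j \<le> b j * g i"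
      by - (rule ratio_chain, auto intro: g step)
  qed
  also have "\<dots> = (\<Sum>j=k0..<k. \<Sum>i=k..m. b j * g i)"
    by (rule sum.swap)
  also have "\<dots> = (\<Sum>j=k0..<k. b j) * (\<Sum>i=k..m. g i)"
    by (rule sum_product [symmetric])
  finally show ?thesis .
qed

section \<open>Tails of the symmetric binomial distribution\<close>

definition binomial_tail :: "nat \<Rightarrow> nat \<Rightarrow> real" where
  "binomial_tail n k = (\<Sum>i=k..n. real (n choose i)) / 2 ^ n"

lemma binomial_tail_head:
  assumes "k \<le> Suc n"
  shows "(\<Sum>i<k. real (n choose i)) / 2 ^ n = binomial_tail n (Suc n - k)"
proof -
  have "(\<Sum>i<k. real (n choose i)) = (\<Sum>i=Suc n - k..n. real (n choose i))"
    using assms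
    by (intro sum.reindex_bij_witness [of _ "\<lambda>i. n - i" "\<lambda>i. n - i"])
       (auto simp: binomial_symmetric [symmetric])
  then show ?thesis by (simp add: binomial_tail_def)
qed

lemma binomial_tail_compl:
  assumes "k \<le> Suc n"
  shows "binomial_tail n (Suc n - k) + binomial_tail n k = 1"
proof -
  have "{..n} = {..<k} \<union> {k..n}" using assms by auto
  then have "(\<Sum>i\<le>n. real (n choose i)) = (\<Sum>i<k. real (n choose i)) + (\<Sum>i=k..n. real (n choose i))"
    by (simp only:) (rule sum.union_disjoint, auto)
  moreover have "(\<Sum>i\<le>n. real (n choose i)) = 2 ^ n"
    by (metis choose_row_sum of_nat_numeral of_nat_power of_nat_sum)
  ultimately show ?thesis
    unfolding binomial_tail_head [OF assms, symmetric]
    by (simp only: binomial_tail_def add_divide_distrib [symmetric])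
      (metis divide_self_if power_not_zero zero_neq_numeral)
qed

lemma binomial_tail_nonneg: "binomial_tail n k \<ge> 0"
  by (simp add: binomial_tail_def sum_nonneg)

lemma binomial_tail_antimono: "k \<le> k' \<Longrightarrow> binomial_tail n k' \<le> binomial_tail n k"
  unfolding binomial_tail_def by (intro divide_right_mono sum_mono2) auto

text \<open>By symmetry the complementary tail is at least as large. The index here and that of the
  next lemma coincide for odd \<open>n\<close> and are adjacent for even \<open>n\<close>; they
  anchor the two tail comparisons at the median.\<close>

lemma binomial_tail_median_le: "binomial_tail n (Suc (n div 2)) \<le> 1 / 2"
  using binomial_tail_compl [of "Suc (n div 2)" n]
    binomial_tail_antimono [of "Suc n - Suc (n div 2)" "Suc (n div 2)" n] by linarith

lemma binomial_tail_median_ge: "binomial_tail n (Suc n div 2) \<ge> 1 / 2"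
  using binomial_tail_compl [of "Suc n div 2" n]
    binomial_tail_antimono [of "Suc n div 2" "Suc n - Suc n div 2" n] by linarith

lemma binomial_ratio:
  assumes "k < n"
  shows "real (n choose Suc k) * (real (n + 1) / 2 + (real k + 1 / 2 - real n / 2))
       = real (n choose k) * (real (n + 1) / 2 - (real k + 1 / 2 - real n / 2))"
proof -
  have "real (n choose Suc k) * real (Suc k) = real (n choose k) * real (n - k)"
    by (metis Suc_times_binomial_eq binomial_absorb_comp mult.commute of_nat_mult
        times_binomial_minus1_eq binomial_absorption)
  then show ?thesis using assms by (simp add: field_simps of_nat_diff)
qed

text \<open>The quotient of consecutive binomial masses is \<open>(1 - y) / (1 + y)\<close>. This
  lemma and the next compare its logarithm with the Gaussian exponent \<open>2 * y\<close>, through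
  derivatives and equality at 0. The factor \<open>1 / (1 - y^2)\<close> of the upper bound is the
  origin of the smaller variance.\<close>

lemma ln_ratio_lower:
  fixes y :: real
  assumes "0 \<le> y" "y < 1"
  shows "2 * y \<le> ln ((1 + y) / (1 - y))"
proof -
  let ?f = "\<lambda>y::real. ln (1 + y) - ln (1 - y) - 2 * y"
  have "?f 0 \<le> ?f y"
  proof (rule DERIV_nonneg_imp_nondecreasing [where f = ?f and a = 0 and b = y])
    fix x assume x: "0 \<le> x" "x \<le> y"
    have "(?f has_real_derivative 1 / (1 + x) + 1 / (1 - x) - 2) (at x)"
      using x assms by (auto intro!: derivative_eq_intros)
    moreover have "1 / (1 + x) + 1 / (1 - x) - 2 = 2 * x\<^sup>2 / ((1 + x) * (1 - x))"
      using x assms by (simp add: divide_simps) (simp add: power2_eq_square algebra_simps)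
    moreover have "2 * x\<^sup>2 / ((1 + x) * (1 - x)) \<ge> 0"
      using x assms by simp
    ultimately show "\<exists>d. (?f has_real_derivative d) (at x) \<and> 0 \<le> d" by auto
  qed (use assms in auto)
  then show ?thesis using assms by (simp add: ln_div)
qed

lemma ln_ratio_upper:
  fixes y :: real
  assumes "0 \<le> y" "y < 1"
  shows "ln ((1 + y) / (1 - y)) \<le> 2 * y / (1 - y\<^sup>2)"
proof -
  let ?f = "\<lambda>y::real. 2 * y / (1 - y\<^sup>2) - (ln (1 + y) - ln (1 - y))"
  have "?f 0 \<le> ?f y"
  proof (rule DERIV_nonneg_imp_nondecreasing [where f = ?f and a = 0 and b = y])
    fix x assume x: "0 \<le> x" "x \<le> y"
    then have x2: "x\<^sup>2 < 1" using assms by (simp add: power_less_one_iff abs_square_less_1)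
    have nz: "1 - x\<^sup>2 \<noteq> 0" "1 + x > 0" "1 - x > 0" using x x2 assms by auto
    have "((\<lambda>y. 2 * y / (1 - y\<^sup>2)) has_real_derivative
        ((2 * 1) * (1 - x\<^sup>2) - (2 * x) * (0 - 2 * x)) / ((1 - x\<^sup>2) * (1 - x\<^sup>2))) (at x)"
      by (rule DERIV_divide) (use nz in \<open>auto intro!: derivative_eq_intros\<close>)
    moreover have "((\<lambda>y. ln (1 + y) - ln (1 - y)) has_real_derivative
        1 / (1 + x) * 1 - 1 / (1 - x) * (- 1)) (at x)"
      using nz by (auto intro!: derivative_eq_intros)
    ultimately have "(?f has_real_derivative ((2 * 1) * (1 - x\<^sup>2) - (2 * x) * (0 - 2 * x)) / ((1 - x\<^sup>2) * (1 - x\<^sup>2))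
        - (1 / (1 + x) * 1 - 1 / (1 - x) * (- 1))) (at x)"
      by (rule DERIV_diff)
    moreover have "((2 * 1) * (1 - x\<^sup>2) - (2 * x) * (0 - 2 * x)) / ((1 - x\<^sup>2) * (1 - x\<^sup>2))
        - (1 / (1 + x) * 1 - 1 / (1 - x) * (- 1)) = 4 * x\<^sup>2 / (1 - x\<^sup>2)\<^sup>2"
    proof -
      have "1 - x\<^sup>2 = (1 + x) * (1 - x)" by (simp add: power2_eq_square algebra_simps)
      then show ?thesis using nz by (simp add: divide_simps) (simp add: power2_eq_square algebra_simps)
    qed
    ultimately show "\<exists>d. (?f has_real_derivative d) (at x) \<and> 0 \<le> d"
      by (intro exI conjI) auto
  qed (use assms in auto)
  then show ?thesis using assms by (simp add: ln_div)
qed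

lemma measure_binomial_half_ge:
  "measure_pmf.prob (binomial_pmf n (1/2)) {y. k \<le> y} = binomial_tail n k"
proof -
  have "measure_pmf.prob (binomial_pmf n (1/2)) {y. k \<le> y}
      = measure_pmf.prob (binomial_pmf n (1/2)) ({y. k \<le> y} \<inter> {..n})"
    by (rule measure_prob_cong_0) (auto simp: pmf_eq_0_set_pmf set_pmf_binomial_eq)
  also have "{y. k \<le> y} \<inter> {..n} = {k..n}" by auto
  also have "measure_pmf.prob (binomial_pmf n (1/2)) {k..n} = (\<Sum>i=k..n. pmf (binomial_pmf n (1/2)) i)"
    by (simp add: measure_measure_pmf_finite)
  also have "\<dots> = (\<Sum>i=k..n. real (n choose i) / 2 ^ n)"
    by (intro sum.cong refl) (simp add: power_add [symmetric] field_simps flip: power_mult_distrib)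
  finally show ?thesis by (simp add: binomial_tail_def sum_divide_distrib)
qed

text \<open>Each cell is the previous one translated by its length \<open>s\<close>, so tilting
  applies with the factor taken at either end. The difference between \<open>3 / 2\<close> and
  \<open>1 / 2\<close> is absorbed by the offset \<open>a\<close>: it is \<open>n / 2 + 1\<close> in
  the upper and \<open>n / 2\<close> in the lower comparison.\<close>

lemma normal_cell_ratio:
  fixes s a :: real
  defines "G \<equiv> \<lambda>i::nat. normal_tail (s * (real i - a)) - normal_tail (s * (real (Suc i) - a))"
  assumes s: "s > 0"
  shows "G i > 0"
    and "exp (- s\<^sup>2 * (real i - a + 3 / 2)) * G i \<le> G (Suc i)"
    and "G (Suc i) \<le> exp (- s\<^sup>2 * (real i - a + 1 / 2)) * G i"
proof -
  have le: "s * (real i - a) < s * (real (Suc i) - a)" for i using s by simp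
  then show "G i > 0"
    using normal_tail_strict_antimono [OF le [of i]] by (simp add: G_def)
  have G: "G i = measure std_normal_distribution {s * (real i - a)<..s * (real (Suc i) - a)}" for i
    using normal_tail_diff [OF less_imp_le [OF le [of i]]] by (simp add: G_def)
  have shift: "(\<lambda>t. t - s) -` {s * (real i - a)<..s * (real (Suc i) - a)}
      = {s * (real (Suc i) - a)<..s * (real (Suc (Suc i)) - a)}"
    by (auto simp: algebra_simps)
  have e: "- s * (s * (real (Suc i) - a)) - s\<^sup>2 / 2 = - s\<^sup>2 * (real i - a + 3 / 2)"
    "- s * (s * (real i - a)) - s\<^sup>2 / 2 = - s\<^sup>2 * (real i - a + 1 / 2)"
    by (simp_all add: power2_eq_square field_simps)
  show "exp (- s\<^sup>2 * (real i - a + 3 / 2)) * G i \<le> G (Suc i)"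
    using std_normal_shift_ge [of "{s * (real i - a)<..s * (real (Suc i) - a)}" s "s * (real (Suc i) - a)"] s
    unfolding G shift e by simp
  show "G (Suc i) \<le> exp (- s\<^sup>2 * (real i - a + 1 / 2)) * G i"
    using std_normal_shift_le [of "{s * (real i - a)<..s * (real (Suc i) - a)}" s "s * (real i - a)"] s
    unfolding G shift e by simp
qed

lemma binomial_tail_split:
  assumes "k0 \<le> k" "k \<le> Suc n"
  shows "(\<Sum>i=k0..<k. real (n choose i) / 2 ^ n) = binomial_tail n k0 - binomial_tail n k"
proof -
  have "{k0..n} = {k0..<k} \<union> {k..n}" using assms by auto
  then have "(\<Sum>i=k0..n. real (n choose i)) = (\<Sum>i=k0..<k. real (n choose i)) + (\<Sum>i=k..n. real (n choose i))"
    by (simp only:) (rule sum.union_disjoint, auto)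
  then show ?thesis
    by (simp add: binomial_tail_def sum_divide_distrib [symmetric] add_divide_distrib)
qed

lemma binomial_step:
  assumes "k < n"
  defines "y \<equiv> (2 * real k + 1 - real n) / real (n + 1)"
  shows "real (n choose Suc k) * (1 + y) = real (n choose k) * (1 - y)"
proof -
  have "1 + y = (real (n + 1) / 2 + (real k + 1 / 2 - real n / 2)) * (2 / real (n + 1))"
    "1 - y = (real (n + 1) / 2 - (real k + 1 / 2 - real n / 2)) * (2 / real (n + 1))"
    by (simp_all add: y_def field_simps)
  then show ?thesis using binomial_ratio [OF assms(1)] by (simp only: mult.assoc [symmetric])
qed

text \<open>With \<open>s^2 = 4 / (n + 1)\<close> and this centre, the lower bound on the cell
  quotient is exactly \<open>exp (- 2 * y)\<close>, which dominates
  \<open>(1 - y) / (1 + y)\<close>. The masses thus decay at least as fast as the cells, and at the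
  median they start from at most \<open>1 / 2\<close> against at least \<open>1 / 2\<close>.\<close>

lemma binomial_tail_le_normal_tail:
  assumes k: "Suc (n div 2) \<le> k" "k \<le> Suc n"
  shows "binomial_tail n k \<le> normal_tail (2 / sqrt (real (n + 1)) * (real k - (real n / 2 + 1)))"
proof -
  define s where "s = 2 / sqrt (real (n + 1))"
  define a where "a = real n / 2 + 1"
  define T where "T = (\<lambda>i::nat. normal_tail (s * (real i - a)))"
  define b where "b = (\<lambda>i. real (n choose i) / 2 ^ n)"
  let ?k0 = "Suc (n div 2)"
  have s: "s > 0" by (simp add: s_def)
  have s2: "s\<^sup>2 = 4 / real (n + 1)" by (simp add: s_def power_divide)
  have cell: "T i - T (Suc i) > 0"
    "exp (- s\<^sup>2 * (real i - a + 3 / 2)) * (T i - T (Suc i)) \<le> T (Suc i) - T (Suc (Suc i))"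
    "T (Suc i) - T (Suc (Suc i)) \<le> exp (- s\<^sup>2 * (real i - a + 1 / 2)) * (T i - T (Suc i))" for i
    unfolding T_def by (rule normal_cell_ratio [OF s])+
  have step: "b (Suc i) * (T i - T (Suc i)) \<le> b i * (T (Suc i) - T (Suc (Suc i)))"
    if i: "?k0 \<le> i" "i < n" for i
  proof -
    define y where "y = (2 * real i + 1 - real n) / real (n + 1)"
    have y: "0 \<le> y" "y < 1" using i by (auto simp: y_def field_simps)
    have "2 * y \<le> ln ((1 + y) / (1 - y))" using y by (rule ln_ratio_lower)
    then have "exp (2 * y) \<le> (1 + y) / (1 - y)" using y by (subst (asm) ln_ge_iff) auto
    then have "exp (2 * y) * (1 - y) \<le> 1 + y" using y by (simp add: pos_le_divide_eq)
    then have "exp (- (2 * y)) * (exp (2 * y) * (1 - y)) \<le> exp (- (2 * y)) * (1 + y)" by simp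
    then have e: "1 - y \<le> exp (- (2 * y)) * (1 + y)"
      by (simp add: mult.assoc [symmetric] exp_add [symmetric])
    have "b (Suc i) * (1 + y) = b i * (1 - y)"
      using binomial_step [OF i(2)] by (simp add: b_def y_def)
    also have "\<dots> \<le> b i * (exp (- (2 * y)) * (1 + y))"
      using e by (intro mult_left_mono) (auto simp: b_def)
    finally have b: "b (Suc i) \<le> b i * exp (- (2 * y))" using y by simp
    have ey: "- s\<^sup>2 * (real i - a + 3 / 2) = - (2 * y)"
      by (simp add: s2 y_def a_def field_simps)
    have "b (Suc i) * (T i - T (Suc i)) \<le> b i * exp (- (2 * y)) * (T i - T (Suc i))"
      using b cell(1) [of i] by (intro mult_right_mono) auto
    also have "\<dots> \<le> b i * (T (Suc i) - T (Suc (Suc i)))"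
      using cell(2) [of i] unfolding ey mult.assoc by (intro mult_left_mono) (auto simp: b_def)
    finally show ?thesis .
  qed
  have main: "(\<Sum>i=k..n. b i) * (\<Sum>i=?k0..<k. T i - T (Suc i)) \<le> (\<Sum>i=?k0..<k. b i) * (\<Sum>i=k..n. T i - T (Suc i))"
    by (rule likelihood_ratio_tails) (use cell(1) step in auto)
  have "(\<Sum>i=k..n. - T (Suc i) - (- T i)) = - T (Suc n) - (- T k)"
    using k by (intro sum_Suc_diff) auto
  then have sumT: "(\<Sum>i=k..n. T i - T (Suc i)) = T k - T (Suc n)" by simp
  have "(\<Sum>i=?k0..<k. - T (Suc i) - (- T i)) = - T k - (- T ?k0)"
    using k by (intro sum_Suc_diff') auto
  then have sumT0: "(\<Sum>i=?k0..<k. T i - T (Suc i)) = T ?k0 - T k" by simp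
  have sumb: "(\<Sum>i=k..n. b i) = binomial_tail n k"
    by (simp add: b_def binomial_tail_def sum_divide_distrib)
  have sumb0: "(\<Sum>i=?k0..<k. b i) = binomial_tail n ?k0 - binomial_tail n k"
    unfolding b_def using k by (rule binomial_tail_split)
  let ?x = "binomial_tail n k"
  have x: "0 \<le> ?x" by (rule binomial_tail_nonneg)
  have b0: "?x \<le> binomial_tail n ?k0" "binomial_tail n ?k0 \<le> 1 / 2"
    using k binomial_tail_antimono [of ?k0 k n] binomial_tail_median_le [of n] by blast+
  have T0: "1 / 2 \<le> T ?k0"
  proof -
    have "2 * Suc (n div 2) \<le> n + 2" by simp
    then have "2 * real ?k0 \<le> real n + 2" by linarith
    then have "s * (real ?k0 - a) \<le> 0" using s by (simp add: a_def mult_nonneg_nonpos)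
    then show ?thesis using normal_tail_antimono [of _ 0] by (simp add: T_def normal_tail_0)
  qed
  have Tn: "0 \<le> T (Suc n)" "0 \<le> T k" by (simp_all add: T_def normal_tail_def)
  have "?x * (T ?k0 - T k) \<le> (binomial_tail n ?k0 - ?x) * (T k - T (Suc n))"
    using main by (simp only: sumT sumT0 sumb sumb0)
  \<comment> \<open>Once \<open>T (Suc n)\<close> is dropped, \<open>?x * T k\<close> occurs on both
    sides and cancels.\<close>
  also have "\<dots> \<le> (binomial_tail n ?k0 - ?x) * T k"
    using b0 Tn by (intro mult_left_mono) auto
  finally have "?x * T ?k0 \<le> binomial_tail n ?k0 * T k" by (simp add: algebra_simps)
  moreover have "?x * (1 / 2) \<le> ?x * T ?k0" using T0 x by (intro mult_left_mono)
  moreover have "binomial_tail n ?k0 * T k \<le> (1 / 2) * T k" using b0 Tn by (intro mult_right_mono)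
  ultimately show ?thesis by (simp add: T_def s_def a_def)
qed

text \<open>Now the cells must decay at least as fast as the masses. By the upper logarithm bound
  this needs \<open>4 <= s^2 * (n + 1) * (1 - y^2)\<close>, so an \<open>s\<close> close to
  \<open>2 / sqrt (n + 1)\<close> works only while \<open>y\<close> stays below some moderate
  \<open>Y\<close>. Hence the steps stop at \<open>K\<close>, and the normal mass beyond it is
  subtracted.\<close>

lemma binomial_tail_ge_normal_tail:
  fixes s Y :: real
  assumes k: "Suc n div 2 \<le> k" "k \<le> K" "K \<le> n"
    and Y: "(2 * real K - 1 - real n) / real (n + 1) \<le> Y" "0 \<le> Y" "Y < 1"
    and s: "s > 0" "4 \<le> s\<^sup>2 * real (n + 1) * (1 - Y\<^sup>2)"
  shows "normal_tail (s * (real k - real n / 2)) - normal_tail (s * (real (Suc K) - real n / 2))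
     \<le> binomial_tail n k"
proof -
  define a where "a = real n / 2"
  define T where "T = (\<lambda>i::nat. normal_tail (s * (real i - a)))"
  define b where "b = (\<lambda>i. real (n choose i) / 2 ^ n)"
  let ?k0 = "Suc n div 2"
  have cell: "T i - T (Suc i) > 0"
    "exp (- s\<^sup>2 * (real i - a + 3 / 2)) * (T i - T (Suc i)) \<le> T (Suc i) - T (Suc (Suc i))"
    "T (Suc i) - T (Suc (Suc i)) \<le> exp (- s\<^sup>2 * (real i - a + 1 / 2)) * (T i - T (Suc i))" for i
    unfolding T_def by (rule normal_cell_ratio [OF s(1)])+
  have step: "(T (Suc i) - T (Suc (Suc i))) * b i \<le> (T i - T (Suc i)) * b (Suc i)"
    if i: "?k0 \<le> i" "i < K" for i
  proof -
    define y where "y = (2 * real i + 1 - real n) / real (n + 1)"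
    have "n \<le> 2 * i" using i by auto
    then have "real n \<le> 2 * real i" by linarith
    then have y: "0 \<le> y" by (simp add: y_def)
    have "y \<le> (2 * real K - 1 - real n) / real (n + 1)"
      unfolding y_def using i by (intro divide_right_mono) auto
    then have yY: "y \<le> Y" using Y by linarith
    then have y1: "y < 1" using Y by linarith
    have y2: "y\<^sup>2 \<le> Y\<^sup>2" "Y\<^sup>2 < 1" using y yY Y by (auto intro: power_mono simp: abs_square_less_1)
    have sm: "s\<^sup>2 * (real i - a + 1 / 2) = s\<^sup>2 * real (n + 1) * y / 2"
      by (simp add: y_def a_def field_simps)
    have "4 * y \<le> s\<^sup>2 * real (n + 1) * (1 - Y\<^sup>2) * y"
      using s y by (intro mult_right_mono)
    also have "\<dots> \<le> s\<^sup>2 * real (n + 1) * (1 - y\<^sup>2) * y"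
      using y2 y by (intro mult_right_mono mult_left_mono) auto
    finally have "2 * y / (1 - y\<^sup>2) \<le> s\<^sup>2 * real (n + 1) * y / 2"
      using y2 by (simp add: field_simps)
    then have "ln ((1 + y) / (1 - y)) \<le> s\<^sup>2 * real (n + 1) * y / 2"
      using ln_ratio_upper [OF y y1] by linarith
    then have "(1 + y) / (1 - y) \<le> exp (s\<^sup>2 * real (n + 1) * y / 2)" (is "_ \<le> exp ?E")
      using y y1 exp_le_cancel_iff [of "ln ((1 + y) / (1 - y))" "?E"] by simp
    then have "1 + y \<le> exp ?E * (1 - y)" using y1 by (simp add: pos_divide_le_eq)
    then have "exp (- ?E) * (1 + y) \<le> exp (- ?E) * (exp ?E * (1 - y))" by simp
    then have e: "exp (- ?E) * (1 + y) \<le> 1 - y"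
      by (simp add: mult.assoc [symmetric] exp_add [symmetric])
    have "b i * exp (- ?E) * (1 + y) \<le> b i * (1 - y)"
      using e unfolding mult.assoc by (intro mult_left_mono) (auto simp: b_def)
    also have "\<dots> = b (Suc i) * (1 + y)"
      using binomial_step [of i n] i k by (simp add: b_def y_def)
    finally have b: "b i * exp (- ?E) \<le> b (Suc i)" using y by simp
    have "(T (Suc i) - T (Suc (Suc i))) * b i \<le> exp (- ?E) * (T i - T (Suc i)) * b i"
      using cell(3) [of i] sm by (intro mult_right_mono) (auto simp: b_def)
    also have "\<dots> = (T i - T (Suc i)) * (b i * exp (- ?E))" by simp
    also have "\<dots> \<le> (T i - T (Suc i)) * b (Suc i)"
      using b cell(1) [of i] by (intro mult_left_mono) auto
    finally show ?thesis .
  qed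
  have main: "(\<Sum>i=k..K. T i - T (Suc i)) * (\<Sum>i=?k0..<k. b i) \<le> (\<Sum>i=?k0..<k. T i - T (Suc i)) * (\<Sum>i=k..K. b i)"
    by (rule likelihood_ratio_tails) (use step k in \<open>auto simp: b_def\<close>)
  have "(\<Sum>i=k..K. - T (Suc i) - (- T i)) = - T (Suc K) - (- T k)"
    using k by (intro sum_Suc_diff) auto
  then have sumT: "(\<Sum>i=k..K. T i - T (Suc i)) = T k - T (Suc K)" by simp
  have "(\<Sum>i=?k0..<k. - T (Suc i) - (- T i)) = - T k - (- T ?k0)"
    using k by (intro sum_Suc_diff') auto
  then have sumT0: "(\<Sum>i=?k0..<k. T i - T (Suc i)) = T ?k0 - T k" by simp
  have sumb: "(\<Sum>i=k..K. b i) \<le> binomial_tail n k"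
    unfolding b_def binomial_tail_def sum_divide_distrib using k by (intro sum_mono2) auto
  have sumb0: "(\<Sum>i=?k0..<k. b i) = binomial_tail n ?k0 - binomial_tail n k"
    unfolding b_def using k by (intro binomial_tail_split) auto
  let ?x = "binomial_tail n k" and ?d = "T k - T (Suc K)"
  have x: "0 \<le> ?x" by (rule binomial_tail_nonneg)
  have b0: "?x \<le> binomial_tail n ?k0" "binomial_tail n ?k0 \<ge> 1 / 2"
    using k binomial_tail_antimono [of ?k0 k n] binomial_tail_median_ge [of n] by blast+
  have Tmono: "T j \<le> T i" if "i \<le> j" for i j
    unfolding T_def using that s by (intro normal_tail_antimono mult_left_mono) auto
  have T0: "T ?k0 \<le> 1 / 2"
  proof -
    have "n \<le> 2 * (Suc n div 2)" by simp
    then have "real n \<le> 2 * real ?k0" by linarith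
    then have "0 \<le> s * (real ?k0 - a)" using s by (simp add: a_def)
    then show ?thesis using normal_tail_antimono [of 0] by (simp add: T_def normal_tail_0)
  qed
  have Tk: "T (Suc K) \<le> T k" "T k \<le> T ?k0" "0 \<le> T (Suc K)"
    using k by (auto intro!: Tmono) (simp add: T_def normal_tail_def)
  have "?d * (1 / 2 - ?x) \<le> ?d * (binomial_tail n ?k0 - ?x)"
    using b0 Tk by (intro mult_left_mono) auto
  also have "\<dots> \<le> (T ?k0 - T k) * (\<Sum>i=k..K. b i)"
    using main by (simp only: sumT sumT0 sumb0)
  also have "\<dots> \<le> (T ?k0 - T k) * ?x"
    using sumb Tk by (intro mult_left_mono) auto
  also have "\<dots> \<le> (1 / 2 - T k) * ?x"
    using x T0 by (intro mult_right_mono) auto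
  finally have "?d / 2 \<le> ?x / 2 - T (Suc K) * ?x" by (simp add: field_simps)
  moreover have "0 \<le> T (Suc K) * ?x" using x Tk by simp
  ultimately have "?d / 2 \<le> ?x / 2 - T (Suc K) * ?x" "0 \<le> T (Suc K) * ?x" by blast+
  then have "?d \<le> ?x" by argo
  then show ?thesis by (simp add: T_def a_def)
qed

subsection \<open>The index gap of the median confidence interval\<close>

lemma floor_half: "\<lfloor>real n / 2\<rfloor> = int (n div 2)"
  by linarith

lemma ceiling_half: "\<lceil>real n / 2\<rceil> = int (Suc n div 2)"
  by linarith

text \<open>Symmetry turns the defining condition into one on an upper tail. The lower bound on
  \<open>n\<close> says that the extreme tail \<open>1 / 2 ^ n\<close> is at most
  \<open>\<alpha> / 2\<close>, so \<open>n div 2 - 1\<close> qualifies. Negative integers fail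
  because their probability is at most \<open>1 / 2\<close>, so the least integer is a natural
  number.\<close>

lemma median_c_charact:
  assumes a: "0 < \<alpha>" "\<alpha> < 1" and n: "log 2 (2 / \<alpha>) \<le> real n"
  obtains c where "median_c n \<alpha> = int c" "c < n div 2"
    "binomial_tail n (Suc n div 2 + c + 1) \<le> \<alpha> / 2"
    "\<And>x. x < c \<Longrightarrow> \<alpha> / 2 < binomial_tail n (Suc n div 2 + x + 1)"
proof -
  define R where "R = (\<lambda>x::nat. binomial_tail n (Suc n div 2 + x + 1) \<le> \<alpha> / 2)"
  have "1 < log 2 (2 / \<alpha>)" using a by (subst less_log_iff) (auto simp: pos_less_divide_eq)
  then have "n \<ge> 2" using n by linarith
  then have n2: "n div 2 \<ge> 1" by linarith
  have "2 powr log 2 (2 / \<alpha>) \<le> 2 powr real n" using n by (intro powr_mono) auto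
  then have "2 / \<alpha> \<le> 2 ^ n" using a by (simp add: powr_realpow)
  then have "1 / 2 ^ n \<le> \<alpha> / 2" using a by (simp add: field_simps)
  moreover have "Suc n div 2 + (n div 2 - 1) + 1 = n" using n2 by linarith
  moreover have "binomial_tail n n = 1 / 2 ^ n" by (simp add: binomial_tail_def)
  ultimately have R1: "R (n div 2 - 1)" by (simp only: R_def)
  define c where "c = (LEAST x. R x)"
  have Rc: "R c" unfolding c_def using R1 by (rule LeastI)
  have c_le: "c \<le> n div 2 - 1" unfolding c_def using R1 by (rule Least_le)
  have least: "\<not> R x" if "x < c" for x using that not_less_Least c_def by blast
  have prob_eq: "measure_pmf.prob (binomial_pmf n (1/2)) {y. int y \<ge> \<lfloor>real n / 2\<rfloor> - int x} \<ge> 1 - \<alpha> / 2 \<longleftrightarrow> R x"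
    if x: "x \<le> n div 2" for x
  proof -
    have "{y. int y \<ge> \<lfloor>real n / 2\<rfloor> - int x} = {y. n div 2 - x \<le> y}"
      unfolding floor_half using x by auto
    then have "measure_pmf.prob (binomial_pmf n (1/2)) {y. int y \<ge> \<lfloor>real n / 2\<rfloor> - int x} = binomial_tail n (n div 2 - x)"
      by (simp only: measure_binomial_half_ge)
    moreover have "Suc n - (n div 2 - x) = Suc n div 2 + x + 1" using x by linarith
    then have "binomial_tail n (n div 2 - x) = 1 - binomial_tail n (Suc n div 2 + x + 1)"
      using binomial_tail_compl [of "n div 2 - x" n] by (simp add: algebra_simps)
    ultimately show ?thesis by (simp add: R_def)
  qed
  have neg: "\<not> measure_pmf.prob (binomial_pmf n (1/2)) {y. int y \<ge> \<lfloor>real n / 2\<rfloor> - x} \<ge> 1 - \<alpha> / 2"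
    if "x < 0" for x :: int
  proof -
    have "measure_pmf.prob (binomial_pmf n (1/2)) {y. int y \<ge> \<lfloor>real n / 2\<rfloor> - x}
        \<le> measure_pmf.prob (binomial_pmf n (1/2)) {y. Suc (n div 2) \<le> y}"
      unfolding floor_half using that by (intro measure_pmf.finite_measure_mono) auto
    also have "\<dots> \<le> 1 / 2"
      unfolding measure_binomial_half_ge by (rule binomial_tail_median_le)
    finally show ?thesis using a by linarith
  qed
  have "median_c n \<alpha> = int c"
    unfolding median_c_def
  proof (rule Least_equality)
    show "1 - \<alpha> / 2 \<le> measure_pmf.prob (binomial_pmf n (1/2)) {y. int y \<ge> \<lfloor>real n / 2\<rfloor> - int c}"
      using prob_eq [of c] Rc c_le by simp
  next
    fix x :: int
    assume x: "1 - \<alpha> / 2 \<le> measure_pmf.prob (binomial_pmf n (1/2)) {y. int y \<ge> \<lfloor>real n / 2\<rfloor> - x}"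
    show "int c \<le> x"
    proof (rule ccontr)
      assume "\<not> int c \<le> x"
      moreover have "0 \<le> x" using x neg [of x] by linarith
      ultimately obtain m where m: "x = int m" "m < c" by (metis nonneg_int_cases not_le of_nat_less_iff)
      then show False using x prob_eq [of m] least [of m] c_le by simp
    qed
  qed
  then show ?thesis
    using c_le n2 Rc least by (intro that [of c]) (auto simp: R_def not_le)
qed

lemma normal_z_pos:
  assumes "0 < a" "a < 1 / 2"
  shows "normal_z a > 0"
  using normal_tail_normal_z [of a] assms normal_tail_antimono [of "normal_z a" 0] normal_tail_0
  by force

lemma normal_z_le:
  assumes "0 < \<alpha>" "\<alpha> < 1"
  shows "(normal_z (\<alpha> / 2))\<^sup>2 \<le> 2 * ln (2 / \<alpha>)"
proof -
  have "\<alpha> / 2 \<le> exp (- (normal_z (\<alpha> / 2))\<^sup>2 / 2)"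
    using normal_tail_bound [of "normal_z (\<alpha> / 2)"] normal_tail_normal_z [of "\<alpha> / 2"]
      normal_z_pos [of "\<alpha> / 2"] assms by simp
  then have "ln (\<alpha> / 2) \<le> - (normal_z (\<alpha> / 2))\<^sup>2 / 2"
    using assms by (metis ln_exp ln_le_cancel_iff half_gt_zero exp_gt_zero)
  then show ?thesis using assms by (simp add: ln_div)
qed

text \<open>Minimality is used at \<open>c - 1\<close>, where the binomial tail is still too large;
  stepping back costs the final 1.\<close>

lemma binomial_quantile_upper:
  fixes z :: real
  assumes z: "z \<ge> 0" and c: "\<And>x. x < c \<Longrightarrow> normal_tail z < binomial_tail n (Suc n div 2 + x + 1)"
    and cn: "c \<le> n div 2"
  shows "real c \<le> z * sqrt (real (n + 1)) / 2 + 1"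
proof (cases c)
  case 0
  then show ?thesis using z by simp
next
  case (Suc x)
  let ?t = "2 / sqrt (real (n + 1)) * (real (Suc n div 2 + x + 1) - (real n / 2 + 1))"
  have "normal_tail z < binomial_tail n (Suc n div 2 + x + 1)" using c Suc by simp
  also have "\<dots> \<le> normal_tail ?t"
    using Suc cn by (intro binomial_tail_le_normal_tail) auto
  finally have "?t < z" using normal_tail_antimono [of z ?t] by force
  moreover have "2 / sqrt (real (n + 1)) * real x \<le> ?t"
  proof (rule mult_left_mono)
    have "n \<le> 2 * (Suc n div 2)" by simp
    then have "real n \<le> 2 * real (Suc n div 2)" by linarith
    then show "real x \<le> real (Suc n div 2 + x + 1) - (real n / 2 + 1)" by simp
  qed simp
  ultimately have "2 / sqrt (real (n + 1)) * real x < z" by linarith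
  then have "2 * real x < z * sqrt (real (n + 1))" by (simp add: pos_divide_less_eq)
  then show ?thesis using Suc by simp
qed

text \<open>
  \<open>K\<close> truncates the binomial tail at distance about \<open>(z + q) * sqrt n / 2\<close> from the centre: close enough
  for the ratio of consecutive masses to stay near the Gaussian one, far enough for the lost normal
  mass beyond \<open>z + q\<close> to be smaller than the mass between \<open>z - 40 / q\<close> and \<open>z\<close>.
\<close>

lemma binomial_quantile_lower:
  fixes z q \<Lambda> :: real
  assumes z: "z > 0" "z \<le> 11 / 100 * q\<^sup>2" and q: "q \<ge> 5" "q ^ 4 = real n" and \<Lambda>: "\<Lambda> \<ge> 6"
    and c: "binomial_tail n (Suc n div 2 + c + 1) \<le> normal_tail z"
  shows "z * q\<^sup>2 / 2 - z * q / 4 - z\<^sup>2 / 8 - 4 * q * \<Lambda> \<le> real c"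
proof (rule ccontr)
  assume "\<not> ?thesis"
  then have c_less: "real c < z * q\<^sup>2 / 2 - z * q / 4 - z\<^sup>2 / 8 - 4 * q * \<Lambda>" by simp
  define w where "w = z / q\<^sup>2"
  have q2: "q\<^sup>2 \<ge> 25" "q\<^sup>2 \<ge> 5 * q" "q > 0"
    using power_mono [OF q(1), of 2] mult_right_mono [OF q(1), of q] q by (auto simp: power2_eq_square)
  have w: "0 < w" "w \<le> 11 / 100"
    using z q2 by (auto simp: w_def pos_divide_le_eq)
  \<comment> \<open>\<open>Y\<close> bounds the ratio parameter \<open>y\<close> at the truncation
    point: \<open>(z + q) / sqrt n\<close>, plus the rounding of \<open>K\<close>.\<close>
  define Y where "Y = w + 1 / q + 1 / real n"
  have nq: "real n = q\<^sup>2 * q\<^sup>2" using q(2) by (simp add: power2_eq_square power4_eq_xxxx)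
  have npos: "real n \<ge> 625" unfolding nq using mult_mono [OF q2(1) q2(1)] by simp
  define v where "v = 1 / q"
  have v: "0 < v" "v \<le> 1 / 5" using q by (auto simp: v_def field_simps)
  have "1 / real n = v * v * v * v" using nq by (simp add: v_def power2_eq_square)
  moreover have "v * v * v \<le> 1 / 5 * (1 / 5) * (1 / 5)"
    using v by (intro mult_mono) auto
  then have "v * v * v * v \<le> 1 / 100 * v" using v by (intro mult_right_mono) auto
  ultimately have Y_le: "Y \<le> w + 101 / 100 * v" "Y \<ge> 0" using w v by (auto simp: Y_def v_def)
  have "Y\<^sup>2 \<le> (w + 101 / 100 * v)\<^sup>2" using Y_le by (intro power_mono)
  also have "\<dots> = w * w + 202 / 100 * w * v + (101 / 100)\<^sup>2 * v * v"
    by (simp add: power2_eq_square algebra_simps)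
  also have "\<dots> \<le> 11 / 100 * w + 202 / 100 * (11 / 100) * v + (101 / 100)\<^sup>2 * (1 / 5) * v"
    using w v by (intro add_mono mult_mono) auto
  also have "\<dots> \<le> 11 / 100 * w + 43 / 100 * v" using v by (simp add: power2_eq_square)
  finally have Y2: "Y\<^sup>2 \<le> 11 / 100 * w + 43 / 100 * v" .
  then have Y2': "Y\<^sup>2 \<le> 1 / 10" using w v by linarith
  have Y1: "Y < 1" using Y_le w v by linarith
  define r where "r = sqrt (real (n + 1))"
  have r: "r > 0" "r\<^sup>2 = real (n + 1)" by (auto simp: r_def)
  have r2: "r\<^sup>2 = q\<^sup>2 * q\<^sup>2 + 1" using r(2) nq by simp
  have "(q\<^sup>2)\<^sup>2 \<le> r\<^sup>2" unfolding r2 by (simp add: power2_eq_square)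
  then have rq: "q\<^sup>2 \<le> r" by (rule power2_le_imp_le) (use r(1) in auto)
  have rq1: "r \<le> q\<^sup>2 + 1"
  proof (rule power2_le_imp_le)
    show "r\<^sup>2 \<le> (q\<^sup>2 + 1)\<^sup>2" unfolding r2 by (simp add: power2_eq_square algebra_simps)
  qed simp
  \<comment> \<open>The smallest \<open>s\<close> that satisfies the variance condition of the tail
    comparison, which then holds with equality.\<close>
  define s where "s = 2 / (r * sqrt (1 - Y\<^sup>2))"
  have s_pos: "s > 0" using r Y2' by (simp add: s_def)
  have s2: "4 \<le> s\<^sup>2 * real (n + 1) * (1 - Y\<^sup>2)"
  proof -
    define W where "W = real (n + 1) * (1 - Y\<^sup>2)"
    have "s\<^sup>2 = 4 / W"
      using Y2' by (simp only: W_def s_def power_divide power_mult_distrib r(2)) simp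
    moreover have "W > 0" unfolding W_def using Y2' by (intro mult_pos_pos) auto
    ultimately have "s\<^sup>2 * W = 4" by simp
    then show ?thesis by (simp only: W_def mult.assoc order_refl)
  qed
  have s_ge: "2 / r \<le> s"
    unfolding s_def using r Y2' by (intro divide_left_mono) (auto simp: mult_le_cancel_left2)
  have s_le: "s \<le> 2 / q\<^sup>2 * (1 + 3 / 5 * Y\<^sup>2)"
  proof -
    have "1 \<le> (1 + 3 / 5 * Y\<^sup>2)\<^sup>2 * (1 - Y\<^sup>2)"
    proof -
      define u where "u = Y\<^sup>2"
      have u: "0 \<le> u" "u \<le> 1 / 10" using Y2' by (auto simp: u_def)
      have "(1 + 3 / 5 * u)\<^sup>2 * (1 - u) - 1 = u * (1 / 5 - 21 / 25 * u - 9 / 25 * (u * u))"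
        by (simp add: power2_eq_square field_simps)
      moreover have "u * u \<le> 1 / 10 * (1 / 10)" using u by (intro mult_mono) auto
      then have "0 \<le> u * (1 / 5 - 21 / 25 * u - 9 / 25 * (u * u))" using u by (intro mult_nonneg_nonneg) auto
      ultimately show ?thesis by (simp add: u_def)
    qed
    then have "sqrt 1 \<le> sqrt ((1 + 3 / 5 * Y\<^sup>2)\<^sup>2 * (1 - Y\<^sup>2))" by (rule real_sqrt_le_mono)
    then have "1 \<le> (1 + 3 / 5 * Y\<^sup>2) * sqrt (1 - Y\<^sup>2)" by (simp add: real_sqrt_mult)
    then have "1 / sqrt (1 - Y\<^sup>2) \<le> 1 + 3 / 5 * Y\<^sup>2" using Y2' by (simp add: pos_divide_le_eq)
    moreover have "2 / r \<le> 2 / q\<^sup>2" using rq q2 by (intro divide_left_mono) auto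
    ultimately have "2 / r * (1 / sqrt (1 - Y\<^sup>2)) \<le> 2 / q\<^sup>2 * (1 + 3 / 5 * Y\<^sup>2)"
      using Y2' r by (intro mult_mono) auto
    then show ?thesis by (simp add: s_def)
  qed
  define k where "k = Suc n div 2 + c + 1"
  define K where "K = nat \<lceil>real n / 2 + (z + q) * r / 2\<rceil>"
  have K_nn: "0 \<le> real n / 2 + (z + q) * r / 2" using z q r by simp
  have K: "real n / 2 + (z + q) * r / 2 \<le> real K" "real K \<le> real n / 2 + (z + q) * r / 2 + 1"
    using K_nn unfolding K_def by linarith+
  have "2 * (Suc n div 2) \<le> n + 1" "n \<le> 2 * (Suc n div 2)" by simp_all
  then have half: "real (Suc n div 2) \<le> real n / 2 + 1 / 2" "real n / 2 \<le> real (Suc n div 2)" by linarith+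
  have k_le: "real k - real n / 2 \<le> real c + 3 / 2" "0 \<le> real k - real n / 2"
    using half by (simp_all add: k_def)
  have q\<Lambda>: "24 * q \<le> 4 * q * \<Lambda>" using q \<Lambda> by simp
  \<comment> \<open>Of the \<open>24 * q\<close>, at most \<open>4 * q\<close> covers the rounding
    term \<open>3 / 2\<close>. The remaining \<open>20 * q\<close> becomes the shift
    \<open>40 / q\<close> when scaled by \<open>2 / q^2\<close>.\<close>
  have B: "real c + 3 / 2 \<le> z * q\<^sup>2 / 2 - z * q / 4 - z\<^sup>2 / 8 - 20 * q"
    using c_less q\<Lambda> q by linarith
  have "z * q\<^sup>2 \<le> (z + q) * r" using z q rq by (intro mult_mono) auto
  moreover have "0 \<le> z * q" "0 \<le> z\<^sup>2" using z q by auto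
  ultimately have "real k \<le> real K" using B k_le K q by linarith
  then have kK: "k \<le> K" by simp
  have KN: "K \<le> n"
  proof -
    have "(z + q) * r \<le> (31 / 100 * q\<^sup>2) * (q\<^sup>2 + 1)"
      using z q q2 rq1 r by (intro mult_mono) auto
    also have "\<dots> = 31 / 100 * real n + 31 / 100 * q\<^sup>2" by (simp add: nq algebra_simps)
    finally have "(z + q) * r \<le> 31 / 100 * real n + 31 / 100 * q\<^sup>2" .
    moreover have "25 * q\<^sup>2 \<le> real n" unfolding nq using q2 by (intro mult_right_mono) auto
    ultimately have "real K \<le> real n" using K(2) npos by linarith
    then show ?thesis by simp
  qed
  have KY: "(2 * real K - 1 - real n) / real (n + 1) \<le> Y"
  proof -
    have "2 * real K - 1 - real n \<le> (z + q) * r + 1" using K(2) by linarith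
    then have "(2 * real K - 1 - real n) / real (n + 1) \<le> ((z + q) * r + 1) / real (n + 1)"
      by (intro divide_right_mono) auto
    also have "\<dots> = (z + q) / r + 1 / real (n + 1)"
      using r(1) unfolding r(2) [symmetric] by (simp add: add_divide_distrib power2_eq_square)
    also have "\<dots> \<le> (z + q) / q\<^sup>2 + 1 / real n"
      using z q q2 rq npos by (intro add_mono divide_left_mono) auto
    also have "\<dots> = Y" using q by (simp add: Y_def w_def add_divide_distrib power2_eq_square)
    finally show ?thesis .
  qed
  have sk: "s * (real k - real n / 2) \<le> z - 40 / q"
  proof -
    define \<sigma> where "\<sigma> = 1 + 3 / 5 * Y\<^sup>2"
    \<comment> \<open>\<open>z * q^2 / 2 * \<rho>\<close> is exactly
      \<open>z * q / 4 + z^2 / 8\<close>. These two terms of the claim pay for the factor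
      \<open>\<sigma>\<close> allowed for \<open>s\<close> over \<open>2 / q^2\<close>, because
      \<open>(1 + \<rho>) * (1 - \<rho>) <= 1\<close>.\<close>
    define \<rho> where "\<rho> = v / 2 + w / 4"
    have \<sigma>: "1 \<le> \<sigma>" "\<sigma> \<le> 1 + \<rho>" using Y2 w v by (auto simp: \<sigma>_def \<rho>_def)
    have \<rho>: "0 \<le> \<rho>" "\<rho> \<le> 1" using w v by (auto simp: \<rho>_def)
    have "\<sigma> * (1 - \<rho>) \<le> (1 + \<rho>) * (1 - \<rho>)" using \<sigma> \<rho> by (intro mult_right_mono) auto
    also have "\<dots> \<le> 1" by (simp add: algebra_simps)
    finally have A: "z * (\<sigma> * (1 - \<rho>)) \<le> z * 1" using z by (intro mult_left_mono) auto
    have "z * q\<^sup>2 / 2 - z * q / 4 - z\<^sup>2 / 8 = z * q\<^sup>2 / 2 * (1 - \<rho>)"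
      using q by (simp add: \<rho>_def v_def w_def power2_eq_square field_simps)
    then have "real k - real n / 2 \<le> z * q\<^sup>2 / 2 * (1 - \<rho>) - 20 * q" using B k_le by linarith
    then have "s * (real k - real n / 2) \<le> (2 / q\<^sup>2 * \<sigma>) * (z * q\<^sup>2 / 2 * (1 - \<rho>) - 20 * q)"
      using s_le k_le s_pos q by (intro mult_mono) (auto simp: \<sigma>_def)
    also have "\<dots> = z * (\<sigma> * (1 - \<rho>)) - \<sigma> * (40 / q)"
      using q by (simp add: field_simps power2_eq_square)
    also have "\<dots> \<le> z - 40 / q"
      using A mult_right_mono [OF \<sigma>(1), of "40 / q"] q by simp
    finally show ?thesis .
  qed
  have z40: "40 / q \<le> z" using sk k_le s_pos mult_nonneg_nonneg [of s "real k - real n / 2"] by linarith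
  have sK: "z + q \<le> s * (real (Suc K) - real n / 2)"
  proof -
    have "(z + q) * r / 2 \<le> real (Suc K) - real n / 2" using K by simp
    then have "2 / r * ((z + q) * r / 2) \<le> s * (real (Suc K) - real n / 2)"
      using s_ge r z q s_pos by (intro mult_mono) auto
    then show ?thesis using r by simp
  qed
  define T where "T = normal_tail z"
  have T: "T > 0"
    using normal_tail_strict_antimono [of z "z + 1"] by (simp add: T_def normal_tail_def)
      (smt (verit) measure_nonneg)
  have "normal_tail (z - 40 / q) - normal_tail (z + q)
      \<le> normal_tail (s * (real k - real n / 2)) - normal_tail (s * (real (Suc K) - real n / 2))"
    using sk sK by (intro diff_mono normal_tail_antimono)
  also have "\<dots> \<le> binomial_tail n k"
    by (rule binomial_tail_ge_normal_tail [OF _ kK KN KY Y_le(2) Y1 s_pos s2]) (simp add: k_def)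
  also have "\<dots> \<le> T" using c by (simp add: k_def T_def)
  finally have contr: "normal_tail (z - 40 / q) \<le> T + normal_tail (z + q)" by simp
  \<comment> \<open>As \<open>40 / q <= z\<close>, moving left by \<open>40 / q\<close> multiplies
    the tail by at least \<open>exp (20 * z / q)\<close>, a relative gain of at least
    \<open>20 * z / q >= 800 / q^2\<close>. The truncated mass is relatively at most
    \<open>exp (- q^2 / 2) <= 2 / q^2\<close>, which is the contradiction.\<close>
  have "T \<le> exp (- (40 / q) * (z - 40 / q) - (40 / q)\<^sup>2 / 2) * normal_tail (z - 40 / q)"
    using normal_tail_shift [of "40 / q" "z - 40 / q"] q by (simp add: T_def)
  also have "\<dots> \<le> exp (- (20 * z / q)) * normal_tail (z - 40 / q)"
  proof (intro mult_right_mono)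
    have vq: "x / q = x * v" for x by (simp add: v_def)
    have "40 * v * (40 * v) \<le> z * (40 * v)" using z40 v by (intro mult_right_mono) (auto simp: vq)
    then show "exp (- (40 / q) * (z - 40 / q) - (40 / q)\<^sup>2 / 2) \<le> exp (- (20 * z / q))"
      by (simp add: vq power2_eq_square algebra_simps)
  qed (simp add: normal_tail_def)
  finally have "exp (20 * z / q) * T \<le> exp (20 * z / q) * (exp (- (20 * z / q)) * normal_tail (z - 40 / q))"
    by simp
  then have "exp (20 * z / q) * T \<le> normal_tail (z - 40 / q)"
    by (simp add: mult.assoc [symmetric] exp_add [symmetric])
  moreover have "(1 + 20 * z / q) * T \<le> exp (20 * z / q) * T"
    using T by (intro mult_right_mono) auto
  ultimately have "(1 + 20 * z / q) * T \<le> T + normal_tail (z + q)" using contr by linarith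
  also have "normal_tail (z + q) \<le> exp (- q * z - q\<^sup>2 / 2) * T"
    using normal_tail_shift [of q z] q by (simp add: T_def)
  finally have "20 * z / q * T \<le> exp (- q * z - q\<^sup>2 / 2) * T" by (simp add: algebra_simps)
  then have "20 * z / q \<le> exp (- q * z - q\<^sup>2 / 2)" by (rule mult_right_le_imp_le [OF _ T])
  also have "\<dots> \<le> exp (- (q\<^sup>2 / 2))" using z q by simp
  also have "\<dots> \<le> 2 / q\<^sup>2"
  proof -
    have "q\<^sup>2 / 2 \<le> exp (q\<^sup>2 / 2)" using exp_ge_add_one_self [of "q\<^sup>2 / 2"] by linarith
    then have "inverse (exp (q\<^sup>2 / 2)) \<le> inverse (q\<^sup>2 / 2)" using q by (intro le_imp_inverse_le) auto
    then show ?thesis by (simp add: exp_minus)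
  qed
  finally have "20 * z / q \<le> 2 / q\<^sup>2" .
  moreover have "20 * (40 / q) / q \<le> 20 * z / q" using z40 q by (intro divide_right_mono mult_left_mono) auto
  ultimately have "20 * (40 / q) / q \<le> 2 / q\<^sup>2" by linarith
  then show False using q by (simp add: power2_eq_square field_simps)
qed

subsection \<open>Spacings of order statistics\<close>

text \<open>Covers both signs, so that one Chernoff bound serves both tails. For
  \<open>x = - y < 0\<close> the polynomial times \<open>exp y\<close> is at least 1, since
  \<open>(1 - y + y^2) * (1 + y + y^2 / 2)\<close> has no negative coefficient.\<close>

lemma exp_quadratic_bound:
  fixes x :: real
  assumes "\<bar>x\<bar> \<le> 1"
  shows "exp x \<le> 1 + x + x\<^sup>2"
proof (cases "x \<ge> 0")
  case True
  then show ?thesis using exp_bound [of x] assms by simp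
next
  case False
  define y where "y = - x"
  have y: "0 \<le> y" using False by (simp add: y_def)
  have "1 \<le> 1 + y\<^sup>2 / 2 + y ^ 3 / 2 + y ^ 4 / 2" using y by simp
  also have "\<dots> = (1 - y + y\<^sup>2) * (1 + y + y\<^sup>2 / 2)"
    by (simp add: power2_eq_square power3_eq_cube power4_eq_xxxx field_simps)
  also have "\<dots> \<le> (1 - y + y\<^sup>2) * exp y"
  proof (rule mult_left_mono)
    have "1 - y + y\<^sup>2 = (y - 1 / 2)\<^sup>2 + 3 / 4" by (simp add: power2_eq_square algebra_simps)
    then show "0 \<le> 1 - y + y\<^sup>2" by simp
  qed (use y exp_lower_Taylor_quadratic in simp)
  finally have "exp x \<le> exp x * ((1 - y + y\<^sup>2) * exp y)" by simp
  also have "\<dots> = 1 - y + y\<^sup>2" by (simp add: y_def exp_minus)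
  finally show ?thesis by (simp add: y_def)
qed

text \<open>Markov's inequality for \<open>exp (s * count)\<close>, whose expectation factorises by
  independence. A negative \<open>s\<close> gives the lower tail.\<close>

lemma (in prob_space) count_tail_bound:
  fixes X :: "'i \<Rightarrow> 'a \<Rightarrow> real" and s l p :: real
  assumes indep: "indep_vars (\<lambda>_. borel) X I" and I: "finite I" and B: "B \<in> sets borel"
    and p: "\<And>i. i \<in> I \<Longrightarrow> prob (X i -` B \<inter> space M) = p" and s: "\<bar>s\<bar> \<le> 1"
  shows "prob {\<omega> \<in> space M. real (card I) * p * (s + s\<^sup>2) + l \<le> s * real (card {i \<in> I. X i \<omega> \<in> B})} \<le> exp (- l)"
proof -
  have X [measurable]: "X i \<in> borel_measurable M" if "i \<in> I" for i
    using indep that by (auto simp: indep_vars_def)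
  define Z where "Z = (\<lambda>i \<omega>. exp (s * indicator B (X i \<omega>)) :: real)"
  have indepZ: "indep_vars (\<lambda>_. borel) Z I"
    unfolding Z_def using B by (intro indep_vars_compose2 [OF indep]) (auto intro!: borel_measurable_continuous_onI measurable_compose [OF _ borel_measurable_exp] borel_measurable_times borel_measurable_indicator)
  have ZI: "Z i \<omega> = 1 + (exp s - 1) * indicator (X i -` B \<inter> space M) \<omega>" if "\<omega> \<in> space M" for i \<omega>
    using that by (auto simp: Z_def indicator_def)
  have sets: "X i -` B \<inter> space M \<in> events" if "i \<in> I" for i
    using X [OF that] B by (rule measurable_sets)
  have int1: "integrable M (\<lambda>\<omega>. 1 + (exp s - 1) * indicator (X i -` B \<inter> space M) \<omega> :: real)" if "i \<in> I" for i
    using sets [OF that] by (intro Bochner_Integration.integrable_add integrable_mult_right integrable_real_indicator)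
      (auto simp: emeasure_eq_measure)
  have intZ: "integrable M (Z i)" if "i \<in> I" for i
    using int1 [OF that] ZI by (subst Bochner_Integration.integrable_cong [OF refl]) auto
  have EZ: "expectation (Z i) = 1 + (exp s - 1) * p" if "i \<in> I" for i
  proof -
    have "expectation (Z i) = expectation (\<lambda>\<omega>. 1 + (exp s - 1) * indicator (X i -` B \<inter> space M) \<omega>)"
      using ZI by (intro Bochner_Integration.integral_cong) auto
    also have "\<dots> = 1 + (exp s - 1) * prob (X i -` B \<inter> space M)"
      using sets [OF that] by (subst Bochner_Integration.integral_add)
        (auto simp: prob_space emeasure_eq_measure intro!: integrable_mult_right integrable_real_indicator)
    finally show ?thesis using p [OF that] by simp
  qed
  have prodZ: "(\<Prod>i\<in>I. Z i \<omega>) = exp (s * real (card {i \<in> I. X i \<omega> \<in> B}))" for \<omega>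
  proof -
    have "(\<Sum>i\<in>I. indicator B (X i \<omega>)) = real (card {i \<in> I. X i \<omega> \<in> B})"
      using I by (simp add: indicator_def sum.If_cases Int_def)
    then show ?thesis
      by (simp add: Z_def exp_sum [OF I, symmetric] sum_distrib_left [symmetric])
  qed
  have E: "expectation (\<lambda>\<omega>. \<Prod>i\<in>I. Z i \<omega>) = (\<Prod>i\<in>I. 1 + (exp s - 1) * p)"
    using indep_vars_lebesgue_integral [OF I indepZ intZ] EZ by simp
  have int: "integrable M (\<lambda>\<omega>. \<Prod>i\<in>I. Z i \<omega>)"
    by (rule indep_vars_integrable [OF I indepZ intZ])
  let ?c = "real (card I) * p * (s + s\<^sup>2) + l"
  have "prob {\<omega> \<in> space M. ?c \<le> s * real (card {i \<in> I. X i \<omega> \<in> B})}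
      = prob {\<omega> \<in> space M. exp ?c \<le> (\<Prod>i\<in>I. Z i \<omega>)}"
    by (simp add: prodZ)
  also have "\<dots> \<le> expectation (\<lambda>\<omega>. \<Prod>i\<in>I. Z i \<omega>) / exp ?c"
    by (rule integral_Markov_inequality_measure [where A = "{}"])
       (use int in \<open>auto intro!: AE_I2 prod_nonneg simp: Z_def\<close>)
  also have "\<dots> = (1 + (exp s - 1) * p) ^ card I / exp ?c" by (simp add: E)
  also have "\<dots> \<le> exp (real (card I) * p * (s + s\<^sup>2)) / exp ?c"
  proof (cases "I = {}")
    case False
    then obtain i where i: "i \<in> I" by blast
    have p0: "0 \<le> p" using p [OF i] by (metis measure_nonneg)
    have "0 \<le> expectation (Z i)" by (intro integral_nonneg_AE AE_I2) (simp add: Z_def)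
    then have pos: "0 \<le> 1 + (exp s - 1) * p" unfolding EZ [OF i] .
    have "1 + (exp s - 1) * p \<le> 1 + (s + s\<^sup>2) * p"
      using exp_quadratic_bound [OF s] p0 by (intro add_left_mono mult_right_mono) auto
    also have "\<dots> \<le> exp ((s + s\<^sup>2) * p)" by (rule exp_ge_add_one_self)
    finally have "(1 + (exp s - 1) * p) ^ card I \<le> exp ((s + s\<^sup>2) * p) ^ card I"
      using pos by (intro power_mono)
    also have "\<dots> = exp (real (card I) * p * (s + s\<^sup>2))"
      by (simp add: exp_of_nat_mult [symmetric] mult_ac)
    finally show ?thesis by (intro divide_right_mono) auto
  qed simp
  also have "\<dots> = exp (- l)" by (simp add: exp_diff [symmetric])
  finally show ?thesis .
qed

lemma order_stat_le_iff:
  assumes k: "1 \<le> k" "k \<le> n"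
  shows "order_stat n x k \<le> t \<longleftrightarrow> k \<le> card {i \<in> {1..n}. x i \<le> t}"
proof -
  define ys where "ys = sort (map x [1..<Suc n])"
  have len: "length ys = n" by (simp add: ys_def)
  have sorted: "ys ! i \<le> ys ! j" if "i \<le> j" "j < n" for i j
    using that by (intro sorted_nth_mono) (auto simp: ys_def)
  have "card {i. i < n \<and> ys ! i \<le> t} = length (filter (\<lambda>y. y \<le> t) ys)"
    by (simp add: length_filter_conv_card len)
  also have "\<dots> = length (filter (\<lambda>i. x i \<le> t) [1..<Suc n])"
    by (simp add: ys_def filter_sort filter_map comp_def del: upt_Suc)
  also have "\<dots> = card (set (filter (\<lambda>i. x i \<le> t) [1..<Suc n]))"
    by (rule distinct_card [symmetric]) simp
  also have "set (filter (\<lambda>i. x i \<le> t) [1..<Suc n]) = {i \<in> {1..n}. x i \<le> t}" by auto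
  finally have card: "card {i. i < n \<and> ys ! i \<le> t} = card {i \<in> {1..n}. x i \<le> t}" .
  have "ys ! (k - 1) \<le> t \<longleftrightarrow> k \<le> card {i. i < n \<and> ys ! i \<le> t}"
  proof
    assume "ys ! (k - 1) \<le> t"
    have "ys ! i \<le> t" "i < n" if "i < k" for i
    proof -
      have "i \<le> k - 1" "k - 1 < n" using that k by linarith+
      then show "ys ! i \<le> t" "i < n" using sorted [of i "k - 1"] \<open>ys ! (k - 1) \<le> t\<close> by linarith+
    qed
    then have "{..<k} \<subseteq> {i. i < n \<and> ys ! i \<le> t}" by auto
    from card_mono [OF _ this] show "k \<le> card {i. i < n \<and> ys ! i \<le> t}" by simp
  next
    assume le: "k \<le> card {i. i < n \<and> ys ! i \<le> t}"
    show "ys ! (k - 1) \<le> t"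
    proof (rule ccontr)
      assume "\<not> ys ! (k - 1) \<le> t"
      then have "i < k - 1" if "i < n" "ys ! i \<le> t" for i
        using sorted [of "k - 1" i] that by (meson leI order_trans)
      then have "{i. i < n \<and> ys ! i \<le> t} \<subseteq> {..<k - 1}" by auto
      from card_mono [OF _ this] le k show False by simp
    qed
  qed
  then show ?thesis by (simp only: order_stat_def ys_def [symmetric] card)
qed

lemma order_stat_mono:
  assumes "1 \<le> j" "j \<le> k" "k \<le> n"
  shows "order_stat n x j \<le> order_stat n x k"
  using order_stat_le_iff [of k n x "order_stat n x k"] order_stat_le_iff [of j n x "order_stat n x k"] assms
  by simp

lemma borel_measurable_order_stat:
  assumes k: "1 \<le> k" "k \<le> n" and X: "\<And>i. i \<in> {1..n} \<Longrightarrow> X i \<in> borel_measurable M"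
  shows "(\<lambda>\<omega>. order_stat n (\<lambda>i. X i \<omega>) k) \<in> borel_measurable M"
proof (rule borel_measurableI_le)
  fix t
  have eq: "real (card {i \<in> {1..n}. X i \<omega> \<le> t}) = (\<Sum>i\<in>{1..n}. indicator {..t} (X i \<omega>))" for \<omega>
    by (simp add: indicator_def sum.If_cases Int_def)
  have "{\<omega> \<in> space M. order_stat n (\<lambda>i. X i \<omega>) k \<le> t}
      = {\<omega> \<in> space M. real k \<le> (\<Sum>i\<in>{1..n}. indicator {..t} (X i \<omega>))}"
    unfolding order_stat_le_iff [OF k] eq [symmetric] by simp
  also have "\<dots> \<in> sets M" using X by measurable
  finally show "{\<omega> \<in> space M. order_stat n (\<lambda>i. X i \<omega>) k \<le> t} \<in> sets M" .
qed

text \<open>The mean enters only through a bound \<open>Q\<close>, since \<open>F\<close> is known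
  only approximately. The free parameter \<open>s\<close> balances \<open>Q * s\<close> against
  \<open>l / s\<close>.\<close>

lemma (in prob_space) count_upper_tail:
  fixes X :: "'i \<Rightarrow> 'a \<Rightarrow> real" and s l p Q v :: real
  assumes indep: "indep_vars (\<lambda>_. borel) X I" and I: "finite I" and B: "B \<in> sets borel"
    and p: "\<And>i. i \<in> I \<Longrightarrow> prob (X i -` B \<inter> space M) = p" and s: "0 < s" "s \<le> 1"
    and Q: "real (card I) * p \<le> Q" and v: "Q * (1 + s) + l / s \<le> v"
  shows "prob {\<omega> \<in> space M. v \<le> real (card {i \<in> I. X i \<omega> \<in> B})} \<le> exp (- l)"
proof -
  have X [measurable]: "X i \<in> borel_measurable M" if "i \<in> I" for i
    using indep that by (auto simp: indep_vars_def)
  have eq: "real (card {i \<in> I. X i \<omega> \<in> B}) = (\<Sum>i\<in>I. indicator B (X i \<omega>))" for \<omega>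
    using I by (simp add: indicator_def sum.If_cases Int_def)
  have c: "real (card I) * p * (s + s\<^sup>2) + l \<le> s * v"
  proof -
    have "real (card I) * p * (s + s\<^sup>2) \<le> Q * (s + s\<^sup>2)"
      using Q s by (intro mult_right_mono) auto
    moreover have "s * (Q * (1 + s) + l / s) \<le> s * v" using v s by (intro mult_left_mono) auto
    moreover have "s * (Q * (1 + s) + l / s) = Q * (s + s\<^sup>2) + l"
      using s by (simp add: power2_eq_square field_simps)
    ultimately show ?thesis by linarith
  qed
  have "prob {\<omega> \<in> space M. v \<le> real (card {i \<in> I. X i \<omega> \<in> B})}
      \<le> prob {\<omega> \<in> space M. real (card I) * p * (s + s\<^sup>2) + l \<le> s * real (card {i \<in> I. X i \<omega> \<in> B})}"
  proof (rule finite_measure_mono)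
    show "{\<omega> \<in> space M. v \<le> real (card {i \<in> I. X i \<omega> \<in> B})}
      \<subseteq> {\<omega> \<in> space M. real (card I) * p * (s + s\<^sup>2) + l \<le> s * real (card {i \<in> I. X i \<omega> \<in> B})}"
      using c s by (auto intro: order_trans mult_left_mono)
    show "{\<omega> \<in> space M. real (card I) * p * (s + s\<^sup>2) + l \<le> s * real (card {i \<in> I. X i \<omega> \<in> B})} \<in> events"
      unfolding eq using B by measurable
  qed
  also have "\<dots> \<le> exp (- l)"
    using s by (intro count_tail_bound [OF indep I B p]) auto
  finally show ?thesis .
qed

lemma (in prob_space) count_lower_tail:
  fixes X :: "'i \<Rightarrow> 'a \<Rightarrow> real" and s l p Q v :: real
  assumes indep: "indep_vars (\<lambda>_. borel) X I" and I: "finite I" and B: "B \<in> sets borel"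
    and p: "\<And>i. i \<in> I \<Longrightarrow> prob (X i -` B \<inter> space M) = p" and s: "0 < s" "s \<le> 1"
    and Q: "Q \<le> real (card I) * p" and v: "v \<le> Q * (1 - s) - l / s"
  shows "prob {\<omega> \<in> space M. real (card {i \<in> I. X i \<omega> \<in> B}) \<le> v} \<le> exp (- l)"
proof -
  have X [measurable]: "X i \<in> borel_measurable M" if "i \<in> I" for i
    using indep that by (auto simp: indep_vars_def)
  have eq: "real (card {i \<in> I. X i \<omega> \<in> B}) = (\<Sum>i\<in>I. indicator B (X i \<omega>))" for \<omega>
    using I by (simp add: indicator_def sum.If_cases Int_def)
  have c: "real (card I) * p * (- s + (- s)\<^sup>2) + l \<le> - s * v"
  proof -
    have "s * s \<le> 1 * s" using s by (intro mult_right_mono) auto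
    then have "Q * (s - s\<^sup>2) \<le> real (card I) * p * (s - s\<^sup>2)"
      using Q s by (intro mult_right_mono) (auto simp: power2_eq_square)
    moreover have "s * v \<le> s * (Q * (1 - s) - l / s)" using v s by (intro mult_left_mono) auto
    moreover have "s * (Q * (1 - s) - l / s) = Q * (s - s\<^sup>2) - l"
      using s by (simp add: power2_eq_square field_simps)
    ultimately show ?thesis by (simp add: algebra_simps)
  qed
  have "prob {\<omega> \<in> space M. real (card {i \<in> I. X i \<omega> \<in> B}) \<le> v}
      \<le> prob {\<omega> \<in> space M. real (card I) * p * (- s + (- s)\<^sup>2) + l \<le> - s * real (card {i \<in> I. X i \<omega> \<in> B})}"
  proof (rule finite_measure_mono)
    show "{\<omega> \<in> space M. real (card {i \<in> I. X i \<omega> \<in> B}) \<le> v}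
      \<subseteq> {\<omega> \<in> space M. real (card I) * p * (- s + (- s)\<^sup>2) + l \<le> - s * real (card {i \<in> I. X i \<omega> \<in> B})}"
    proof safe
      fix \<omega> assume "real (card {i \<in> I. X i \<omega> \<in> B}) \<le> v"
      then have "- s * v \<le> - s * real (card {i \<in> I. X i \<omega> \<in> B})" using s by simp
      with c show "real (card I) * p * (- s + (- s)\<^sup>2) + l \<le> - s * real (card {i \<in> I. X i \<omega> \<in> B})" by linarith
    qed
    show "{\<omega> \<in> space M. real (card I) * p * (- s + (- s)\<^sup>2) + l \<le> - s * real (card {i \<in> I. X i \<omega> \<in> B})} \<in> events"
      unfolding eq using B by measurable
  qed
  also have "\<dots> \<le> exp (- l)"
    using s by (intro count_tail_bound [OF indep I B p]) auto
  finally show ?thesis .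
qed

lemma grid_cell:
  fixes a b y :: real
  assumes "a < y" "y \<le> b" "m > 0"
  defines "g \<equiv> (b - a) / real m"
  obtains i where "i < m" "a + real i * g < y" "y \<le> a + real (Suc i) * g"
proof -
  have g: "g > 0" using assms by (simp add: g_def)
  define t where "t = (y - a) / g"
  have t: "0 < t" "t \<le> real m" and y: "y = a + t * g"
    using assms g by (auto simp: t_def g_def field_simps)
  define i where "i = nat (\<lceil>t\<rceil> - 1)"
  have "real i < t" "t \<le> real (Suc i)" "i < m"
    using t unfolding i_def by linarith+
  then show ?thesis
    using g by (intro that [of i]) (auto simp: y)
qed

lemma card_between:
  fixes x :: "nat \<Rightarrow> real"
  assumes "s \<le> t"
  shows "card {i \<in> {1..n}. x i \<le> t} = card {i \<in> {1..n}. x i \<le> s} + card {i \<in> {1..n}. x i \<in> {s<..t}}"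
proof -
  have "{i \<in> {1..n}. x i \<le> t} = {i \<in> {1..n}. x i \<le> s} \<union> {i \<in> {1..n}. x i \<in> {s<..t}}"
    using assms by auto
  then show ?thesis by (simp only:) (rule card_Un_disjoint, auto)
qed

text \<open>At least \<open>l\<close> observations are at most \<open>s\<close>, and at most
  \<open>u - 1\<close> are at most \<open>t\<close>. In the next lemma these numbers are
  \<open>l - 1\<close> and \<open>u\<close>, with the inequalities reversed, so the two thresholds
  differ by 2.\<close>

lemma order_stat_gap_large:
  fixes x :: "nat \<Rightarrow> real"
  assumes lu: "1 \<le> l" "l < u" "u \<le> n" and st: "s \<le> t"
    and A: "order_stat n x l \<le> s" and B: "t < order_stat n x u"
  shows "real (card {i \<in> {1..n}. x i \<in> {s<..t}}) \<le> real u - 1 - real l"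
  using card_between [OF st, of n x] order_stat_le_iff [of l n x s] order_stat_le_iff [of u n x t] assms
  by (auto simp: not_le)

lemma order_stat_gap_small:
  fixes x :: "nat \<Rightarrow> real"
  assumes lu: "1 \<le> l" "l < u" "u \<le> n" and st: "s \<le> t"
    and A: "s < order_stat n x l" and B: "order_stat n x u \<le> t"
  shows "real u - real l + 1 \<le> real (card {i \<in> {1..n}. x i \<in> {s<..t}})"
  using card_between [OF st, of n x] order_stat_le_iff [of l n x s] order_stat_le_iff [of u n x t] assms
  by (auto simp: not_le)

text \<open>
  If the spacing exceeds \<open>D\<^sub>1\<close> or falls short of \<open>D\<^sub>2\<close>, then the grid cell that contains the lower order
  statistic starts an interval of about that length with too few or too many observations.
\<close>

lemma (in prob_space) order_stat_spacing:
  fixes X :: "nat \<Rightarrow> 'a \<Rightarrow> real" and F :: "real \<Rightarrow> real" and a b m E s e D\<^sub>1 D\<^sub>2 :: real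
  assumes indep: "indep_vars (\<lambda>_. borel) X {1..n}"
    and F: "\<And>i t. i \<in> {1..n} \<Longrightarrow> cdf (distr M borel (X i)) t = F t"
    and lu: "1 \<le> l" "l < u" "u \<le> n" and ab: "a < b" and m: "m > 0" and E: "E \<ge> 0"
    and lin: "\<And>s t. a \<le> s \<Longrightarrow> s \<le> t \<Longrightarrow> t \<le> b \<Longrightarrow> \<bar>F t - F s - m * (t - s)\<bar> \<le> E"
    and s: "0 < s" "s \<le> 1" and e: "e > 0"
  defines "g \<equiv> (b - a) / real n"
  assumes up: "real u - 1 - real l \<le> real n * (m * (D\<^sub>1 - g) - E) * (1 - s) - e / s"
    and low: "real n * (m * (D\<^sub>2 + g) + E) * (1 + s) + e / s \<le> real u - real l + 1"
  defines "A \<equiv> \<lambda>\<omega>. order_stat n (\<lambda>i. X i \<omega>) l" and "B \<equiv> \<lambda>\<omega>. order_stat n (\<lambda>i. X i \<omega>) u"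
  shows "prob {\<omega> \<in> space M. a < A \<omega> \<and> B \<omega> \<le> b \<and> \<not> (D\<^sub>2 \<le> B \<omega> - A \<omega> \<and> B \<omega> - A \<omega> \<le> D\<^sub>1)}
     \<le> 2 * real n * exp (- e)"
proof -
  have n: "n > 0" using lu by simp
  have g: "g > 0" using ab n by (simp add: g_def)
  have X [measurable]: "X i \<in> borel_measurable M" if "i \<in> {1..n}" for i
    using indep that by (auto simp: indep_vars_def)
  have p: "prob (X i -` {v<..w} \<inter> space M) = F w - F v" if "i \<in> {1..n}" "v \<le> w" for i v w
  proof -
    interpret D: prob_space "distr M borel (X i)" using that by (intro prob_space_distr) auto
    interpret D: real_distribution "distr M borel (X i)"
      by (simp add: real_distribution_def real_distribution_axioms_def D.prob_space_axioms)
    show ?thesis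
    proof (cases "v < w")
      case True
      then have "F w - F v = measure (distr M borel (X i)) {v<..w}"
        using D.cdf_diff_eq [of v w] F that by simp
      then show ?thesis using X [OF that(1)] by (simp add: measure_distr)
    qed (use that in simp)
  qed
  define t where "t = (\<lambda>i. a + real i * g)"
  define N where "N = (\<lambda>\<omega> v w. real (card {i \<in> {1..n}. X i \<omega> \<in> {v<..w}}))"
  \<comment> \<open>Starting at the right end of the cell and ending at
    \<open>t i + D\<^sub>1\<close>, the interval lies between the two order statistics if their
    spacing exceeds \<open>D\<^sub>1\<close>; this costs one cell length \<open>g\<close>.\<close>
  define up_bad where "up_bad = (\<lambda>i. {\<omega> \<in> space M. N \<omega> (t (Suc i)) (t i + D\<^sub>1) \<le> real u - 1 - real l})"
  \<comment> \<open>The second kind of interval starts at the left end of the cell, so it catches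
    both order statistics if they are too close. It is cut off at \<open>b\<close>, beyond which
    \<open>lin\<close> gives nothing.\<close>
  define w where "w = (\<lambda>i. min (t (Suc i) + D\<^sub>2) b)"
  define low_bad where "low_bad = (\<lambda>i. {\<omega> \<in> space M. real u - real l + 1 \<le> N \<omega> (t i) (w i)})"
  define I1 where "I1 = {i. i < n \<and> t i + D\<^sub>1 \<le> b}"
  define I2 where "I2 = {i. i < n \<and> t i \<le> w i}"
  have fin: "finite I1" "finite I2" "card I1 \<le> n" "card I2 \<le> n"
    using card_mono [of "{..<n}" I1] card_mono [of "{..<n}" I2] by (auto simp: I1_def I2_def)
  have tS: "t (Suc i) = t i + g" and ta: "a \<le> t i" for i
    using g by (auto simp: t_def algebra_simps)
  have Neq: "N \<omega> v w = (\<Sum>i\<in>{1..n}. indicator {v<..w} (X i \<omega>))" for \<omega> v w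
    by (simp add: N_def indicator_def sum.If_cases Int_def)
  have sets: "up_bad i \<in> events" "low_bad i \<in> events" for i
    unfolding up_bad_def low_bad_def Neq by measurable
  \<comment> \<open>Otherwise the right-hand side of \<open>up\<close> would be negative while its
    left-hand side is not. This orders the end points of the interval in
    \<open>up_bad\<close>.\<close>
  have gD: "g \<le> D\<^sub>1"
  proof (rule ccontr)
    assume "\<not> g \<le> D\<^sub>1"
    then have "m * (D\<^sub>1 - g) - E \<le> 0" using m E by (smt (verit) mult_pos_pos mult_minus_right)
    then have "real n * (m * (D\<^sub>1 - g) - E) * (1 - s) \<le> 0"
      using s by (intro mult_nonpos_nonneg mult_nonneg_nonpos) auto
    moreover have "e / s > 0" using e s by simp
    ultimately show False using up lu by linarith
  qed
  have up_prob: "prob (up_bad i) \<le> exp (- e)" if "i \<in> I1" for i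
    unfolding up_bad_def N_def
  proof (rule count_lower_tail [OF indep _ _ p s])
    have "m * ((t i + D\<^sub>1) - t (Suc i)) - E \<le> F (t i + D\<^sub>1) - F (t (Suc i))"
    proof -
      have "t i + D\<^sub>1 \<le> b" using that by (simp add: I1_def)
      then have "\<bar>F (t i + D\<^sub>1) - F (t (Suc i)) - m * ((t i + D\<^sub>1) - t (Suc i))\<bar> \<le> E"
        using lin [of "t (Suc i)" "t i + D\<^sub>1"] ta [of "Suc i"] gD tS [of i] by linarith
      then show ?thesis by linarith
    qed
    then show "real n * (m * (D\<^sub>1 - g) - E) \<le> real (card {1..n}) * (F (t i + D\<^sub>1) - F (t (Suc i)))"
      by (auto simp: tS intro!: mult_left_mono)
  qed (use gD up in \<open>auto simp: tS\<close>)
  have low_prob: "prob (low_bad i) \<le> exp (- e)" if "i \<in> I2" for i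
    unfolding low_bad_def N_def
  proof (rule count_upper_tail [OF indep _ _ p s])
    have "F (w i) - F (t i) \<le> m * (w i - t i) + E"
      using lin [of "t i" "w i"] that ta by (auto simp: I2_def w_def abs_le_iff)
    also have "\<dots> \<le> m * (D\<^sub>2 + g) + E"
      using m by (intro add_right_mono mult_left_mono) (auto simp: w_def tS)
    finally show "real (card {1..n}) * (F (w i) - F (t i)) \<le> real n * (m * (D\<^sub>2 + g) + E)"
      by (simp add: mult_left_mono)
  qed (use that low in \<open>auto simp: I2_def\<close>)
  have "{\<omega> \<in> space M. a < A \<omega> \<and> B \<omega> \<le> b \<and> \<not> (D\<^sub>2 \<le> B \<omega> - A \<omega> \<and> B \<omega> - A \<omega> \<le> D\<^sub>1)}
      \<subseteq> (\<Union>i\<in>I1. up_bad i) \<union> (\<Union>i\<in>I2. low_bad i)"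
  proof (intro subsetI, rule ccontr)
    fix \<omega> assume "\<omega> \<in> {\<omega> \<in> space M. a < A \<omega> \<and> B \<omega> \<le> b \<and> \<not> (D\<^sub>2 \<le> B \<omega> - A \<omega> \<and> B \<omega> - A \<omega> \<le> D\<^sub>1)}"
    then have \<omega>: "\<omega> \<in> space M" and aA: "a < A \<omega>" and Bb: "B \<omega> \<le> b"
      and gap: "\<not> (D\<^sub>2 \<le> B \<omega> - A \<omega> \<and> B \<omega> - A \<omega> \<le> D\<^sub>1)" by auto
    assume not_bad: "\<omega> \<notin> (\<Union>i\<in>I1. up_bad i) \<union> (\<Union>i\<in>I2. low_bad i)"
    have AB: "A \<omega> \<le> B \<omega>" unfolding A_def B_def using lu by (intro order_stat_mono) auto
    obtain i where i: "i < n" "t i < A \<omega>" "A \<omega> \<le> t (Suc i)"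
      using grid_cell [of a "A \<omega>" b n] aA AB Bb n unfolding t_def g_def by auto
    have "D\<^sub>2 \<le> B \<omega> - A \<omega>"
    proof (rule ccontr)
      assume "\<not> ?thesis"
      then have Bw: "B \<omega> \<le> w i" using i Bb by (simp add: w_def)
      then have tw: "t i \<le> w i" using i AB by linarith
      have "\<omega> \<in> low_bad i"
        using order_stat_gap_small [OF lu tw, of "\<lambda>i. X i \<omega>"] i Bw \<omega>
        by (simp add: low_bad_def N_def A_def B_def)
      then show False using not_bad tw i by (auto simp: I2_def)
    qed
    then have "D\<^sub>1 < B \<omega> - A \<omega>" using gap by auto
    then have tB: "t i + D\<^sub>1 < B \<omega>" using i by linarith
    have "\<omega> \<in> up_bad i"
      using order_stat_gap_large [OF lu, of "t (Suc i)" "t i + D\<^sub>1" "\<lambda>i. X i \<omega>"] i tB \<omega> gD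
      by (simp add: up_bad_def N_def A_def B_def tS)
    then show False using not_bad i tB Bb by (auto simp: I1_def)
  qed
  then have "prob {\<omega> \<in> space M. a < A \<omega> \<and> B \<omega> \<le> b \<and> \<not> (D\<^sub>2 \<le> B \<omega> - A \<omega> \<and> B \<omega> - A \<omega> \<le> D\<^sub>1)}
      \<le> prob ((\<Union>i\<in>I1. up_bad i) \<union> (\<Union>i\<in>I2. low_bad i))"
    using sets fin by (intro finite_measure_mono) auto
  also have "\<dots> \<le> prob (\<Union>i\<in>I1. up_bad i) + prob (\<Union>i\<in>I2. low_bad i)"
    using sets fin by (intro measure_Un_le) auto
  also have "\<dots> \<le> (\<Sum>i\<in>I1. prob (up_bad i)) + (\<Sum>i\<in>I2. prob (low_bad i))"
    using sets fin by (intro add_mono measure_UNION_le) auto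
  also have "\<dots> \<le> (\<Sum>i\<in>I1. exp (- e)) + (\<Sum>i\<in>I2. exp (- e))"
    using up_prob low_prob by (intro add_mono sum_mono)
  also have "\<dots> = real (card I1) * exp (- e) + real (card I2) * exp (- e)" by simp
  also have "\<dots> \<le> real n * exp (- e) + real n * exp (- e)"
    using fin by (intro add_mono mult_right_mono) auto
  finally show ?thesis by simp
qed

subsection \<open>The width ratio\<close>

text \<open>Bootstrapping: a crude bound on the logarithm gives \<open>n >= 64\<close>, which
  improves the logarithm and gives \<open>n >= 625\<close>. As \<open>625 = 5 ^ 4\<close>, this
  yields \<open>q >= 5\<close>; and \<open>2 ^ 9 <= n\<close> yields the bound 6.\<close>

lemma ln_sample_size_bounds:
  assumes n: "n \<ge> 1" "169 * ln (2 * real n) \<le> real n"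
  shows "real n \<ge> 625" "ln (real n) \<ge> 6"
proof -
  have pow: "2 / 3 * real k \<le> ln x" if "2 ^ k \<le> x" for k and x :: real
  proof -
    have "2 / 3 * real k \<le> ln 2 * real k" using ln2_ge_two_thirds by (intro mult_right_mono) auto
    also have "\<dots> = ln (2 ^ k)" by (simp add: ln_realpow)
    also have "\<dots> \<le> ln x" using that by (subst ln_le_cancel_iff) (auto intro: less_le_trans [of _ "2 ^ k"])
    finally show ?thesis .
  qed
  have "2 / 3 \<le> ln (2 * real n)" using pow [of 1 "2 * real n"] n by simp
  then have "real n \<ge> 64" using n by linarith
  then have "2 / 3 * 7 \<le> ln (2 * real n)" using pow [of 7 "2 * real n"] by simp
  then have "real n \<ge> 625" using n by linarith
  then show "real n \<ge> 625" "ln (real n) \<ge> 6" using pow [of 9 "real n"] by simp_all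
qed

theorem theorem2:
  fixes P :: "'a measure" and X :: "nat \<Rightarrow> 'a \<Rightarrow> real" and F :: "real \<Rightarrow> real"
    and \<theta>\<^sub>0 M C \<delta> \<eta> \<zeta> \<alpha> :: real and n :: nat
  assumes "prob_space P"
    and indep: "prob_space.indep_vars P (\<lambda>_. borel) X {1..n}"
    and distr_F: "\<And>i t. i \<in> {1..n} \<Longrightarrow> cdf (distr P borel (X i)) t = F t"
    and median: "F \<theta>\<^sub>0 = 1/2"
    and pos: "M > 0" "C > 0" "\<delta> > 0" "\<eta> > 0"
    and local_lin: "\<And>h. \<bar>h\<bar> < \<eta> \<Longrightarrow>
           \<bar>F (\<theta>\<^sub>0 + h) - F \<theta>\<^sub>0 - M * h\<bar> \<le> C * \<bar>h\<bar> powr (1 + \<delta>)"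
    and zeta: "\<zeta> = (M / 2) * min \<eta> ((M / (2 * C)) powr (1 / \<delta>))"
    and alpha: "0 < \<alpha>" "\<alpha> < 1"
    and n_ge: "real n \<ge> log 2 (2 / \<alpha>)"
    and n_large: "real n \<ge> 49 * ln (2 * real n / \<alpha>) / \<zeta>\<^sup>2"
  shows "measure P {\<omega> \<in> space P.
           \<bar>width_ratio n \<alpha> M (\<lambda>i. X i \<omega>) - 1\<bar>
             \<le> (1 + 14 * ln (real n) / normal_z (\<alpha> / 2)) / real n powr (1/4)
               + sqrt (ln (2 / \<alpha>) / (8 * real n))
               + 2 * C * 14 powr (1 + \<delta>) * ln (2 * real n / \<alpha>) powr ((1 + \<delta>) / 2)
                 / (normal_z (\<alpha> / 2) * M powr (1 + \<delta>) * real n powr (\<delta> / 2))}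
         \<ge> 1 - 6 / (real n)\<^sup>2"
proof -
  interpret prob_space P by fact
  have "1 < log 2 (2 / \<alpha>)" using alpha by (subst less_log_iff) (auto simp: pos_less_divide_eq)
  then have n1: "real n > 1" using n_ge by linarith
  then have n: "n \<ge> 1" "n > 0" by auto

  \<comment> \<open>The neighbourhood of the median\<close>
  define L where "L = ln (2 * real n / \<alpha>)"
  have L_eq: "L = ln (2 / \<alpha>) + ln (real n)"
    using n alpha by (simp add: L_def ln_mult ln_div)
  have lnpos: "0 < ln (2 / \<alpha>)" "0 < ln (real n)" using alpha n1 by (auto simp: less_divide_eq)
  have L2: "ln (2 * real n) \<le> L"
    using n alpha lnpos by (simp add: L_def ln_mult ln_div)
  have L_pos: "L > 0" using L_eq lnpos by simp
  \<comment> \<open>\<open>n * r\<close> is the common scale for \<open>c\<close> and for the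
    Chernoff deviations, so the neighbourhood is a multiple of \<open>r / M\<close>.\<close>
  define r where "r = sqrt (L / real n)"
  have r: "r > 0" "r\<^sup>2 = L / real n" using L_pos n by (auto simp: r_def)
  \<comment> \<open>\<open>14 * r / M\<close> may equal \<open>\<eta>\<close>, where \<open>local_lin\<close> says nothing.\<close>
  define h where "h = 13 * r / M"
  define h0 where "h0 = min \<eta> ((M / (2 * C)) powr (1 / \<delta>))"
  have h0: "h0 > 0" "h0 \<le> \<eta>" "h0 \<le> (M / (2 * C)) powr (1 / \<delta>)" using pos by (auto simp: h0_def)
  have \<zeta>: "\<zeta> = M / 2 * h0" "\<zeta> > 0"
    unfolding zeta h0_def [symmetric] using h0 pos by simp_all
  have "7 * r \<le> \<zeta>"
  proof (rule power2_le_imp_le)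
    have "49 * L \<le> real n * \<zeta>\<^sup>2" using n_large \<zeta>(2) by (simp add: L_def pos_divide_le_eq)
    then have "(7 * r)\<^sup>2 * real n \<le> \<zeta>\<^sup>2 * real n"
      using n r by (simp add: power_mult_distrib mult_ac)
    then show "(7 * r)\<^sup>2 \<le> \<zeta>\<^sup>2" using n by simp
  qed (use \<zeta> in simp)
  then have "13 * r < M * h0" using \<zeta>(1) r by simp
  then have h: "0 < h" "h < h0" "M * h = 13 * r"
    using pos r by (auto simp: h_def field_simps)
  then have h_\<eta>: "h < \<eta>" using h0 by linarith
  define E where "E = C * h powr (1 + \<delta>)"
  have "h powr \<delta> \<le> ((M / (2 * C)) powr (1 / \<delta>)) powr \<delta>"
    using h h0 pos by (intro powr_mono2) auto
  then have hd: "C * h powr \<delta> \<le> M / 2" using pos by (simp add: powr_powr field_simps)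
  have E: "0 \<le> E" "E \<le> 13 / 2 * r"
  proof -
    have "E = (C * h powr \<delta>) * h" using h by (simp add: E_def powr_add)
    also have "\<dots> \<le> M / 2 * h" using hd h by (intro mult_right_mono) auto
    finally show "E \<le> 13 / 2 * r" using h by simp
  qed (use pos in \<open>simp add: E_def\<close>)
  have loc: "\<bar>F (\<theta>\<^sub>0 + t) - 1 / 2 - M * t\<bar> \<le> E" if "\<bar>t\<bar> \<le> h" for t
  proof -
    have "\<bar>F (\<theta>\<^sub>0 + t) - 1 / 2 - M * t\<bar> \<le> C * \<bar>t\<bar> powr (1 + \<delta>)"
      using local_lin [of t] median that h_\<eta> by simp
    also have "\<dots> \<le> E" unfolding E_def using that pos by (intro mult_left_mono powr_mono2) auto
    finally show ?thesis .
  qed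
  have X [measurable]: "X i \<in> borel_measurable P" if "i \<in> {1..n}" for i
    using indep that by (auto simp: indep_vars_def)
  have prob_le: "prob (X i -` {..t} \<inter> space P) = F t" if "i \<in> {1..n}" for i t
    using distr_F [OF that] X [OF that] by (simp add: cdf_def measure_distr)
  have F01: "0 \<le> F t" "F t \<le> 1" for t
    using prob_le [of 1 t, symmetric] n by auto
  \<comment> \<open>At least half of the linear increase \<open>M * h = 13 * r\<close> survives the
    error \<open>E\<close>. In the localisation \<open>13 / 2\<close> is spent as
    \<open>7 / 2\<close> for \<open>c\<close> with rounding and \<open>3\<close> for the deviation
    of the counts.\<close>
  have F_up: "1 / 2 + 13 / 2 * r \<le> F (\<theta>\<^sub>0 + h)" using loc [of h] h E by simp
  have F_low: "F (\<theta>\<^sub>0 - h) \<le> 1 / 2 - 13 / 2 * r" using loc [of "- h"] h E by simp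
  \<comment> \<open>\<open>F \<le> 1\<close> bounds \<open>r\<close>, so the assumption on the sample size alone forces \<open>n \<ge> 169 * L\<close>.\<close>
  have r13: "r \<le> 1 / 13" using F_up F01 [of "\<theta>\<^sub>0 + h"] by linarith
  have nr2: "real n * r\<^sup>2 = L" using r n by simp
  have "r\<^sup>2 \<le> (1 / 13)\<^sup>2" using r13 r by (intro power_mono) auto
  then have "real n * r\<^sup>2 \<le> real n * (1 / 13)\<^sup>2" by (intro mult_left_mono) auto
  then have nL: "169 * L \<le> real n" unfolding nr2 by (simp add: power2_eq_square)
  have n625: "real n \<ge> 625" "ln (real n) \<ge> 6"
    using ln_sample_size_bounds [of n] n nL L2 by auto

  \<comment> \<open>The scale \<open>q\<close>, the normal quantile and the ranks\<close>
  define \<Lambda> where "\<Lambda> = ln (real n)"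
  define q where "q = real n powr (1 / 4)"
  have q4: "q ^ 4 = real n" using n by (simp add: q_def powr_powr flip: powr_realpow)
  have q5: "q \<ge> 5"
  proof (rule ccontr)
    assume "\<not> q \<ge> 5"
    moreover have "0 \<le> q" by (simp add: q_def)
    ultimately have "q ^ 4 < 5 ^ 4" by (intro power_strict_mono) auto
    then show False using n625 q4 by simp
  qed
  have q2: "q\<^sup>2 = sqrt (real n)"
    using q4 by (intro real_sqrt_unique [symmetric]) (simp_all flip: power_mult)
  define z where "z = normal_z (\<alpha> / 2)"
  have z: "z > 0" "z\<^sup>2 \<le> 2 * ln (2 / \<alpha>)"
    using normal_z_pos [of "\<alpha> / 2"] normal_z_le [of \<alpha>] alpha by (auto simp: z_def)
  have zL: "z\<^sup>2 \<le> 2 * L" using z lnpos L_eq by simp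
  have zq: "z \<le> 11 / 100 * q\<^sup>2"
  proof (rule power2_le_imp_le)
    have "z\<^sup>2 \<le> 2 / 169 * real n" using zL nL by linarith
    also have "\<dots> \<le> (11 / 100)\<^sup>2 * real n" using n by (intro mult_right_mono) (auto simp: power2_eq_square)
    finally show "z\<^sup>2 \<le> (11 / 100 * q\<^sup>2)\<^sup>2" unfolding q2 power_mult_distrib by simp
  qed simp
  have Tz: "normal_tail z = \<alpha> / 2" using normal_tail_normal_z [of "\<alpha> / 2"] alpha by (simp add: z_def)
  obtain c where c: "median_c n \<alpha> = int c" "c < n div 2"
    "binomial_tail n (Suc n div 2 + c + 1) \<le> normal_tail z"
    "\<And>x. x < c \<Longrightarrow> normal_tail z < binomial_tail n (Suc n div 2 + x + 1)"
    using median_c_charact [OF alpha n_ge] unfolding Tz by blast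
  have c_up: "real c \<le> z * sqrt (real (n + 1)) / 2 + 1"
    using z c by (intro binomial_quantile_upper) auto
  have c_low: "z * q\<^sup>2 / 2 - z * q / 4 - z\<^sup>2 / 8 - 4 * q * \<Lambda> \<le> real c"
    using z zq q5 q4 n625 c by (intro binomial_quantile_lower [where n = n]) (auto simp: \<Lambda>_def)
  have rn: "sqrt (real (n + 1)) \<le> q\<^sup>2 + 1"
    by (rule real_le_lsqrt) (use q2 in \<open>simp_all add: power2_eq_square algebra_simps\<close>)
  define l where "l = n div 2 - c"
  define u where "u = Suc n div 2 + c + 1"
  have lu: "1 \<le> l" "l < u" "u \<le> n" using c(2) by (auto simp: l_def u_def)
  have lu_diff: "2 * real c + 1 \<le> real u - real l" "real u - real l \<le> 2 * real c + 2"
  proof -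
    have "u + c = l + (n mod 2) + 3 * c + 1" "n mod 2 \<le> 1"
      using c(2) by (auto simp: l_def u_def) presburger
    then show "2 * real c + 1 \<le> real u - real l" "real u - real l \<le> 2 * real c + 2" by linarith+
  qed
  have lu_half: "real n / 2 - 1 / 2 - real c \<le> real l" "real u \<le> real n / 2 + 3 / 2 + real c"
    using c(2) by (auto simp: l_def u_def)
  define A where "A = (\<lambda>\<omega>. order_stat n (\<lambda>i. X i \<omega>) l)"
  define B where "B = (\<lambda>\<omega>. order_stat n (\<lambda>i. X i \<omega>) u)"
  have AB [measurable]: "A \<in> borel_measurable P" "B \<in> borel_measurable P"
    unfolding A_def B_def using lu X by (auto intro!: borel_measurable_order_stat)
  have nq: "real n = q\<^sup>2 * q\<^sup>2" using q2 by simp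
  \<comment> \<open>The Chernoff parameter balances the variance term \<open>n p s\<close>, about \<open>z q / 2\<close>, and \<open>3 ln n / s = 6 q ln n\<close>.\<close>
  define s where "s = 1 / (2 * q)"

  \<comment> \<open>The claimed bound on the scale of counts\<close>
  define rhs where "rhs = (1 + 14 * \<Lambda> / z) / q + sqrt (ln (2 / \<alpha>) / (8 * real n))
      + 2 * C * 14 powr (1 + \<delta>) * L powr ((1 + \<delta>) / 2) / (z * M powr (1 + \<delta>) * real n powr (\<delta> / 2))"
  \<comment> \<open>The nonlinearity term of \<open>rhs\<close> as a count. It has to cover
    \<open>2 * E\<close>, because \<open>F\<close> is linearised at both ends of an
    interval.\<close>
  define W where "W = real n * (2 * C * (14 * r / M) powr (1 + \<delta>))"
  have W: "2 * real n * E \<le> W"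
  proof -
    have "h powr (1 + \<delta>) \<le> (14 * r / M) powr (1 + \<delta>)"
      using h pos r by (intro powr_mono2) (auto simp: h_def divide_right_mono)
    then show ?thesis using n pos by (simp add: W_def E_def mult_left_mono)
  qed
  \<comment> \<open>\<open>z * q^2\<close> is the linearised expected count in an interval of the
    Wald width.\<close>
  have rhs_eq: "z * q\<^sup>2 * rhs = z * q + 14 * q * \<Lambda> + z * sqrt (ln (2 / \<alpha>) / 8) + W"
  proof -
    have 1: "z * q\<^sup>2 * ((1 + 14 * \<Lambda> / z) / q) = z * q + 14 * q * \<Lambda>"
      using z q5 by (simp add: power2_eq_square field_simps)
    have "sqrt (ln (2 / \<alpha>) / (8 * real n)) = sqrt (ln (2 / \<alpha>) / 8) / q\<^sup>2"
      by (simp add: q2 real_sqrt_divide real_sqrt_mult)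
    then have 2: "z * q\<^sup>2 * sqrt (ln (2 / \<alpha>) / (8 * real n)) = z * sqrt (ln (2 / \<alpha>) / 8)"
      using q5 by simp
    have "r powr (1 + \<delta>) = ((L / real n) powr (1 / 2)) powr (1 + \<delta>)"
      using L_pos by (simp add: r_def powr_half_sqrt)
    also have "\<dots> = (L / real n) powr ((1 + \<delta>) / 2)" by (simp add: powr_powr)
    also have "\<dots> = L powr ((1 + \<delta>) / 2) / real n powr ((1 + \<delta>) / 2)"
      using L_pos by (simp add: powr_divide)
    also have "real n powr ((1 + \<delta>) / 2) = real n powr (1 / 2) * real n powr (\<delta> / 2)"
      by (simp add: powr_add [symmetric] add_divide_distrib)
    also have "real n powr (1 / 2) = q\<^sup>2" using n by (simp add: powr_half_sqrt q2)
    finally have rp: "r powr (1 + \<delta>) = L powr ((1 + \<delta>) / 2) / (q\<^sup>2 * real n powr (\<delta> / 2))" .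
    have "(14 * r / M) powr (1 + \<delta>) = 14 powr (1 + \<delta>) * r powr (1 + \<delta>) / M powr (1 + \<delta>)"
      using r pos by (simp add: powr_divide powr_mult)
    then have "W = q\<^sup>2 * q\<^sup>2 * (2 * C * (14 powr (1 + \<delta>) * (L powr ((1 + \<delta>) / 2) / (q\<^sup>2 * real n powr (\<delta> / 2))) / M powr (1 + \<delta>)))"
      using nq rp by (simp only: W_def)
    also have "\<dots> = q\<^sup>2 * (2 * C * 14 powr (1 + \<delta>) * L powr ((1 + \<delta>) / 2) / (M powr (1 + \<delta>) * real n powr (\<delta> / 2)))"
    proof -
      have cancel: "x * x * (2 * C * (y * (w / (x * v)) / p)) = x * (2 * C * y * w / (p * v))" if "x \<noteq> 0" for x y w v p
        using that by (simp add: mult_ac)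
      show ?thesis by (rule cancel) (use q5 in simp)
    qed
    also have "\<dots> = z * q\<^sup>2 * (2 * C * 14 powr (1 + \<delta>) * L powr ((1 + \<delta>) / 2)
        / (z * M powr (1 + \<delta>) * real n powr (\<delta> / 2)))"
      using z by simp
    finally show ?thesis unfolding rhs_def distrib_left 1 2 by linarith
  qed
  \<comment> \<open>The loss \<open>z^2 / 8\<close> in the bound for \<open>c\<close> counts twice
    in \<open>u - l\<close>; given \<open>z^2 <= 2 * ln (2 / \<alpha>)\<close>, the square root term
    just covers it.\<close>
  have sqrt_ge: "z\<^sup>2 / 4 \<le> z * sqrt (ln (2 / \<alpha>) / 8)"
  proof -
    have "z / 4 \<le> sqrt (ln (2 / \<alpha>) / 8)"
      by (rule real_le_rsqrt) (use z in \<open>simp add: power_divide\<close>)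
    then have "z * (z / 4) \<le> z * sqrt (ln (2 / \<alpha>) / 8)" using z by (intro mult_left_mono) auto
    then show ?thesis by (simp add: power2_eq_square)
  qed
  \<comment> \<open>\<open>z / (M * q^2)\<close> is the Wald width, so spacings from
    \<open>D2\<close> to \<open>D1\<close> are those whose width ratio is within \<open>rhs\<close>
    of 1.\<close>
  define D1 where "D1 = z * (1 + rhs) / (M * q\<^sup>2)"
  define D2 where "D2 = z * (1 - rhs) / (M * q\<^sup>2)"
  define a where "a = \<theta>\<^sub>0 - h"
  define b where "b = \<theta>\<^sub>0 + h"
  define g where "g = (b - a) / real n"
  have nM: "real n * (M * D1) = z * q\<^sup>2 + z * q\<^sup>2 * rhs" "real n * (M * D2) = z * q\<^sup>2 - z * q\<^sup>2 * rhs"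
    "real n * (M * g) = 26 * r"
  proof -
    have D_eq: "real n * (M * (x / (M * q\<^sup>2))) = x * q\<^sup>2" for x
    proof -
      have cancel: "y * y * (M * (x / (M * y))) = x * y" if "y \<noteq> 0" for y
        using that pos by simp
      show ?thesis unfolding nq by (rule cancel) (use q5 in simp)
    qed
    show "real n * (M * D1) = z * q\<^sup>2 + z * q\<^sup>2 * rhs"
      unfolding D1_def by (simp only: D_eq) (simp add: algebra_simps)
    show "real n * (M * D2) = z * q\<^sup>2 - z * q\<^sup>2 * rhs"
      unfolding D2_def by (simp only: D_eq) (simp add: algebra_simps)
    have "real n * (M * g) = M * h * 2" using n by (simp add: g_def a_def b_def)
    then show "real n * (M * g) = 26 * r" using h by simp
  qed
  have q_ineqs: "5 * z \<le> z * q" "5 * \<Lambda> \<le> q * \<Lambda>" "6 \<le> \<Lambda>" "0 < 1 / q" "1 / q \<le> 1"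
    using z q5 n625 by (auto simp: \<Lambda>_def)
  have z_sqrt: "z * sqrt (real (n + 1)) \<le> z * q\<^sup>2 + z"
    using mult_left_mono [OF rn, of z] z by (simp add: algebra_simps)
  have ls: "3 * \<Lambda> / s = 6 * (q * \<Lambda>)" by (simp add: s_def)
  have qs: "z * q\<^sup>2 * s = z * q / 2" "z * q * s = z / 2" "14 * q * \<Lambda> * s = 7 * \<Lambda>" "2 * s = 1 / q" "0 < s" "s < 1"
    using q5 by (simp_all add: s_def power2_eq_square)
  have up: "real u - 1 - real l \<le> real n * (M * (D1 - g) - 2 * E) * (1 - s) - 3 * \<Lambda> / s"
  proof -
    \<comment> \<open>The 2 pays for one grid cell: \<open>n * M * g = 26 * r <= 2\<close>.\<close>
    define Q0 where "Q0 = z * q\<^sup>2 + z * q + 14 * q * \<Lambda> - 2"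
    have "0 \<le> z * sqrt (ln (2 / \<alpha>) / 8)" using z lnpos by simp
    moreover have "real n * (M * (D1 - g) - 2 * E) = real n * (M * D1) - real n * (M * g) - 2 * real n * E"
      by (simp add: algebra_simps)
    ultimately have "Q0 \<le> real n * (M * (D1 - g) - 2 * E)"
      using W r13 by (simp only: nM rhs_eq Q0_def)
    then have "Q0 * (1 - s) \<le> real n * (M * (D1 - g) - 2 * E) * (1 - s)"
      using qs by (intro mult_right_mono) auto
    moreover have "Q0 * (1 - s) = Q0 - (z * q\<^sup>2 * s + z * q * s + 14 * q * \<Lambda> * s - 2 * s)"
      by (simp add: Q0_def algebra_simps)
    moreover have "real u - 1 - real l \<le> z * q\<^sup>2 + z + 3" using lu_diff c_up z_sqrt by linarith
    ultimately show ?thesis unfolding qs ls Q0_def using q_ineqs z by linarith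
  qed
  have low: "real n * (M * (D2 + g) + 2 * E) * (1 + s) + 3 * \<Lambda> / s \<le> real u - real l + 1"
  proof -
    \<comment> \<open>The critical side: of \<open>z * q\<close>, half is consumed by
      \<open>z * q^2 * s\<close> and half by twice the loss \<open>z * q / 4\<close> in
      \<open>c_low\<close>; of 14, the Chernoff term takes 6 and twice the 4 of \<open>c_low\<close>
      takes 8.\<close>
    define Q1 where "Q1 = z * q\<^sup>2 - z * q - 14 * q * \<Lambda> - z\<^sup>2 / 4 + 2"
    have "real n * (M * (D2 + g) + 2 * E) = real n * (M * D2) + real n * (M * g) + 2 * real n * E"
      by (simp add: algebra_simps)
    then have "real n * (M * (D2 + g) + 2 * E) \<le> Q1"
      using W r13 sqrt_ge by (simp only: nM rhs_eq Q1_def)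
    then have "real n * (M * (D2 + g) + 2 * E) * (1 + s) \<le> Q1 * (1 + s)"
      using qs by (intro mult_right_mono) auto
    moreover have "Q1 * (1 + s) = Q1 + (z * q\<^sup>2 * s - z * q * s - 14 * q * \<Lambda> * s - z\<^sup>2 / 4 * s + 2 * s)"
      by (simp add: Q1_def algebra_simps)
    moreover have "0 \<le> z\<^sup>2 / 4 * s" using qs by simp
    moreover have "2 * real c + 2 \<le> real u - real l + 1" using lu_diff by linarith
    ultimately show ?thesis unfolding qs ls Q1_def using q_ineqs c_low z by linarith
  qed
  \<comment> \<open>The exponent \<open>3 * \<Lambda>\<close> leaves \<open>2 / n^2\<close> after
    the union over at most \<open>2 * n\<close> intervals.\<close>
  have spacing: "prob {\<omega> \<in> space P. a < A \<omega> \<and> B \<omega> \<le> b \<and> \<not> (D2 \<le> B \<omega> - A \<omega> \<and> B \<omega> - A \<omega> \<le> D1)}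
     \<le> 2 * real n * exp (- (3 * \<Lambda>))"
    unfolding A_def B_def
  proof (rule order_stat_spacing [OF indep distr_F lu])
    show "a < b" "0 < M" "0 \<le> 2 * E" "0 < s" "s \<le> 1" "0 < 3 * \<Lambda>"
      using h pos E q5 lnpos by (auto simp: a_def b_def s_def \<Lambda>_def)
    fix v w assume vw: "a \<le> v" "v \<le> w" "w \<le> b"
    show "\<bar>F w - F v - M * (w - v)\<bar> \<le> 2 * E"
    proof -
      have "\<bar>w - \<theta>\<^sub>0\<bar> \<le> h" "\<bar>v - \<theta>\<^sub>0\<bar> \<le> h" using vw by (auto simp: a_def b_def)
      then have "\<bar>F w - 1 / 2 - M * (w - \<theta>\<^sub>0)\<bar> \<le> E" "\<bar>F v - 1 / 2 - M * (v - \<theta>\<^sub>0)\<bar> \<le> E"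
        using loc [of "w - \<theta>\<^sub>0"] loc [of "v - \<theta>\<^sub>0"] by simp_all
      moreover have "F w - F v - M * (w - v)
          = (F w - 1 / 2 - M * (w - \<theta>\<^sub>0)) - (F v - 1 / 2 - M * (v - \<theta>\<^sub>0))"
        by (simp add: algebra_simps)
      ultimately show ?thesis by linarith
    qed
  qed (use up low in \<open>simp_all add: g_def\<close>)

  \<comment> \<open>Localisation of both order statistics\<close>
  define s' where "s' = sqrt (2 * \<Lambda> / real n)"
  \<comment> \<open>Here the mean count is bounded only by \<open>n\<close>, and \<open>s'\<close>
    equalises \<open>n * s'\<close> with \<open>2 * \<Lambda> / s'\<close>. Together they are at
    most \<open>3 * n * r\<close>.\<close>
  have s': "0 < s'" "s' \<le> 1" "s' \<le> 3 / 2 * r" "2 * \<Lambda> / s' = real n * s'"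
  proof -
    have s2: "s'\<^sup>2 = 2 * \<Lambda> / real n" using q_ineqs by (simp add: s'_def)
    show s0: "0 < s'" using q_ineqs n by (simp add: s'_def)
    have \<Lambda>L: "\<Lambda> \<le> L" using L_eq lnpos by (simp add: \<Lambda>_def)
    show "s' \<le> 1"
      by (rule power2_le_imp_le) (use \<Lambda>L nL n L_pos in \<open>simp_all add: s2\<close>)
    show "s' \<le> 3 / 2 * r"
    proof (rule power2_le_imp_le)
      have "2 * \<Lambda> / real n \<le> 9 / 4 * L / real n" using \<Lambda>L L_pos by (intro divide_right_mono) auto
      then show "s'\<^sup>2 \<le> (3 / 2 * r)\<^sup>2" by (simp add: s2 r power_mult_distrib power_divide)
    qed (use r in simp)
    have "2 * \<Lambda> = real n * s' * s'" using s2 n by (simp add: power2_eq_square field_simps)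
    then show "2 * \<Lambda> / s' = real n * s'" using s0 by simp
  qed
  have c_nr: "real c + 3 / 2 \<le> 7 / 2 * (real n * r)"
  proof -
    have "z \<le> 3 / 2 * (r * q\<^sup>2)"
    proof (rule power2_le_imp_le)
      have "(3 / 2 * (r * q\<^sup>2))\<^sup>2 = 9 / 4 * L"
        using nr2 nq by (simp add: power_mult_distrib power_divide power2_eq_square mult_ac)
      then show "z\<^sup>2 \<le> (3 / 2 * (r * q\<^sup>2))\<^sup>2" using zL L_pos by linarith
    qed (use r in simp)
    then have "z * q\<^sup>2 \<le> 3 / 2 * (r * q\<^sup>2) * q\<^sup>2" by (intro mult_right_mono) auto
    then have zq2: "z * q\<^sup>2 \<le> 3 / 2 * (real n * r)" by (simp add: nq mult_ac)
    have "1 \<le> q\<^sup>2" using q5 by (simp add: one_le_power)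
    then have "z * 1 \<le> z * q\<^sup>2" using z by (intro mult_left_mono) auto
    moreover have "13 * L \<le> real n * r"
    proof -
      have "L = (real n * r) * r" using nr2 by (simp add: power2_eq_square)
      also have "\<dots> \<le> (real n * r) * (1 / 13)" using r13 r by (intro mult_left_mono) auto
      finally show ?thesis by simp
    qed
    moreover have "6 \<le> L" using L_eq lnpos n625 by linarith
    ultimately show ?thesis using c_up z_sqrt zq2 by linarith
  qed
  have loc_B: "prob {\<omega> \<in> space P. \<not> B \<omega> \<le> b} \<le> exp (- (2 * \<Lambda>))"
  proof -
    have "{\<omega> \<in> space P. \<not> B \<omega> \<le> b} = {\<omega> \<in> space P. real (card {i \<in> {1..n}. X i \<omega> \<in> {..b}}) \<le> real u - 1}"
      unfolding B_def using lu by (auto simp: order_stat_le_iff)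
    also have "prob \<dots> \<le> exp (- (2 * \<Lambda>))"
    proof (rule count_lower_tail [OF indep _ _ prob_le s'(1,2) order_refl])
      have "F b * s' \<le> 1 * s'" using F01 s' by (intro mult_right_mono) auto
      then have "real n * (F b * s') \<le> real n * s'" by (intro mult_left_mono) auto
      moreover have "real n * (1 / 2 + 13 / 2 * r) \<le> real n * F b"
        using F_up by (intro mult_left_mono) (auto simp: b_def)
      moreover have "real n * s' \<le> real n * (3 / 2 * r)" using s' by (intro mult_left_mono) auto
      ultimately show "real u - 1 \<le> real (card {1..n}) * F b * (1 - s') - 2 * \<Lambda> / s'"
        using c_nr lu_half unfolding s' by (simp add: algebra_simps)
    qed auto
    finally show ?thesis .
  qed
  have loc_A: "prob {\<omega> \<in> space P. A \<omega> \<le> a} \<le> exp (- (2 * \<Lambda>))"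
  proof -
    have "{\<omega> \<in> space P. A \<omega> \<le> a} = {\<omega> \<in> space P. real l \<le> real (card {i \<in> {1..n}. X i \<omega> \<in> {..a}})}"
      unfolding A_def using lu by (auto simp: order_stat_le_iff)
    also have "prob \<dots> \<le> exp (- (2 * \<Lambda>))"
    proof (rule count_upper_tail [OF indep _ _ prob_le s'(1,2) order_refl])
      have "F a * s' \<le> 1 * s'" using F01 s' by (intro mult_right_mono) auto
      then have "real n * (F a * s') \<le> real n * s'" by (intro mult_left_mono) auto
      moreover have "real n * F a \<le> real n * (1 / 2 - 13 / 2 * r)"
        using F_low by (intro mult_left_mono) (auto simp: a_def)
      moreover have "real n * s' \<le> real n * (3 / 2 * r)" using s' by (intro mult_left_mono) auto
      ultimately show "real (card {1..n}) * F a * (1 + s') + 2 * \<Lambda> / s' \<le> real l"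
        using c_nr lu_half unfolding s' by (simp add: algebra_simps)
    qed auto
    finally show ?thesis .
  qed

  \<comment> \<open>From the spacing to the width ratio, and the union bound\<close>
  have ratio: "width_ratio n \<alpha> M (\<lambda>i. X i \<omega>) = q\<^sup>2 * M / z * (B \<omega> - A \<omega>)" for \<omega>
  proof -
    have idx: "nat (\<lfloor>real n / 2\<rfloor> - median_c n \<alpha>) = l" "nat (\<lceil>real n / 2\<rceil> + median_c n \<alpha> + 1) = u"
      unfolding floor_half ceiling_half c(1) l_def u_def using c(2) by linarith+
    have "order_stat n (\<lambda>i. X i \<omega>) l \<le> order_stat n (\<lambda>i. X i \<omega>) u"
      using lu by (intro order_stat_mono) auto
    then show ?thesis
      using width_ratio_eq [of M \<alpha> n "\<lambda>i. X i \<omega>", unfolded idx] pos z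
      by (simp add: z_def A_def B_def q2)
  qed
  define good where "good = {\<omega> \<in> space P. \<bar>q\<^sup>2 * M / z * (B \<omega> - A \<omega>) - 1\<bar> \<le> rhs}"
  let ?S = "{\<omega> \<in> space P. a < A \<omega> \<and> B \<omega> \<le> b \<and> \<not> (D2 \<le> B \<omega> - A \<omega> \<and> B \<omega> - A \<omega> \<le> D1)}"
  let ?SB = "{\<omega> \<in> space P. \<not> B \<omega> \<le> b}" and ?SA = "{\<omega> \<in> space P. A \<omega> \<le> a}"
  have good_sets: "good \<in> events" "?S \<in> events" "?SB \<in> events" "?SA \<in> events"
    unfolding good_def by measurable
  have "space P \<subseteq> good \<union> (?S \<union> (?SB \<union> ?SA))"
  proof
    fix \<omega> assume \<omega>: "\<omega> \<in> space P"
    have "\<omega> \<in> good" if D: "D2 \<le> B \<omega> - A \<omega>" "B \<omega> - A \<omega> \<le> D1"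
    proof -
      have k: "0 \<le> q\<^sup>2 * M / z" using pos z by simp
      have "q\<^sup>2 * M / z * D1 = 1 + rhs" "q\<^sup>2 * M / z * D2 = 1 - rhs"
        using pos z q5 by (simp_all add: D1_def D2_def)
      then show ?thesis
        using mult_left_mono [OF D(1) k] mult_left_mono [OF D(2) k] \<omega> by (auto simp: good_def abs_le_iff)
    qed
    then show "\<omega> \<in> good \<union> (?S \<union> (?SB \<union> ?SA))" using \<omega> by auto
  qed
  then have "1 \<le> prob (good \<union> (?S \<union> (?SB \<union> ?SA)))"
    using finite_measure_mono [of "space P" "good \<union> (?S \<union> (?SB \<union> ?SA))"] good_sets prob_space by auto
  also have "\<dots> \<le> prob good + (prob ?S + (prob ?SB + prob ?SA))"
    using good_sets
    by (intro order_trans [OF measure_Un_le] add_mono order_refl) auto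
  also have "\<dots> \<le> prob good + (2 * real n * exp (- (3 * \<Lambda>)) + (exp (- (2 * \<Lambda>)) + exp (- (2 * \<Lambda>))))"
    using spacing loc_B loc_A by (intro add_mono) auto
  also have "exp (- (2 * \<Lambda>)) = 1 / (real n)\<^sup>2"
    using n by (simp add: \<Lambda>_def exp_minus exp_of_nat_mult [of 2 "ln (real n)", simplified] inverse_eq_divide)
  also have "exp (- (3 * \<Lambda>)) = 1 / (real n) ^ 3"
    using n by (simp add: \<Lambda>_def exp_minus exp_of_nat_mult [of 3 "ln (real n)", simplified] inverse_eq_divide)
  also have "2 * real n * (1 / (real n) ^ 3) = 2 / (real n)\<^sup>2"
    using n by (simp add: power2_eq_square power3_eq_cube)
  finally have "1 \<le> prob good + 4 / (real n)\<^sup>2" by simp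
  moreover have "4 / (real n)\<^sup>2 \<le> 6 / (real n)\<^sup>2" by (intro divide_right_mono) auto
  ultimately have "1 - 6 / (real n)\<^sup>2 \<le> prob good" by linarith
  then show ?thesis
    unfolding good_def ratio rhs_def z_def L_def \<Lambda>_def q_def .
qed

end
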